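(* Let $\Theta_0$ be an L-system (with one-dimensional input-output space $\mathbb C$ and $J=1$) with symmetric operator $\dot A$, main operator $T_0$ and quasi-kernel $\hat A_0$ of the real part of its state-space operator, satisfying the following Hypothesis: there are normalized $g_\pm\in\mathrm{Ker}(\dot A^*\mp iI)$ with $g_+-g_-\in\mathrm{Dom}(\hat A_0)$ and $g_+-\kappa_0g_-\in\mathrm{Dom}(T_0)$ for some $|\kappa_0|<1$. Suppose that the impedance function $V_{\Theta_0}(z)$ belongs to the class $\mathfrak M$. Then for any real number $Q\ne0$ there exists another L-system $\Theta^Q$ with the same symmetric operator $\dot A$ as in $\Theta_0$ and such that $$V_{\Theta^Q}(z)=Q+V_{\Theta_0}(z).$$ Moreover, the von Neumann parameter of its main operator $T^Q$ is $$\kappa(Q)=\frac{|Q|}{\sqrt{Q^2+4}},$$ while the quasi-kernel $\hat A^Q$ of $\mathrm{Re}\,\mathbb A^Q$ of the L-system $\Theta^Q$ has von Neumann parameter $$U=\frac{Q}{|Q|}\cdot\frac{-Q+2i}{\sqrt{Q^2+4}}.$$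
   Context: Class $\mathfrak M$: functions $M(z)=\int_{\mathbb R}\left(\frac{1}{\lambda-z}-\frac{\lambda}{1+\lambda^2}\right)d\mu(\lambda)$ with $\mu$ an infinite Borel measure and $\int_{\mathbb R}\frac{d\mu(\lambda)}{1+\lambda^2}=1$. Rigged space: for a closed densely defined prime symmetric operator $\dot A$ with deficiency indices $(1,1)$ in a complex Hilbert space $\mathcal H$, let $\mathcal H_+=\mathrm{Dom}(\dot A^* )$ with $(f,g)_+=(f,g)+(\dot A^*f,\dot A^*g)$, and let $\mathcal H_+\subset\mathcal H\subset\mathcal H_-$ be the associated rigged Hilbert space. $[X,Y]$ denotes bounded linear operators. If $\mathbb A\in[\mathcal H_+,\mathcal H_-]$ then $\mathbb A^*\in[\mathcal H_+,\mathcal H_-]$; $\mathrm{Re}\,\mathbb A=(\mathbb A+\mathbb A^* )/2$, $\mathrm{Im}\,\mathbb A=(\mathbb A-\mathbb A^* )/2i$. The quasi-kernel $\hat A$ of $\mathrm{Re}\,\mathbb A$ is its restriction to $\{f\in\mathcal H_+:\mathrm{Re}\,\mathbb A f\in\mathcal H\}$. L-system: let $T$ be a non-symmetric operator with $\dot A\subset T\subset\dot A^*$, $\rho(T)\ne\emptyset$, $\mathrm{Dom}(\dot A)=\mathrm{Dom}(T)\cap\mathrm{Dom}(T^* )$. A $( * )$-extension of $T$ is $\mathbb A\in[\mathcal H_+,\mathcal H_-]$ with $\dot A\subset T\subset\mathbb A$, $\dot A\subset T^*\subset\mathbb A^*$ such that the quasi-kernel $\hat A$ of $\mathrm{Re}\,\mathbb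 A$ is self-adjoint in $\mathcal H$. An L-system is $\Theta=\begin{pmatrix}\mathbb A&K&1\\ \mathcal H_+\subset\mathcal H\subset\mathcal H_-&&\mathbb C\end{pmatrix}$ where $\mathbb A$ is a $( * )$-extension of such a $T$ (main operator; it is then maximal dissipative), $K\in[\mathbb C,\mathcal H_-]$, $\mathrm{Im}\,\mathbb A=KK^*$, $\mathrm{Ran}(K)=\mathrm{Ran}(\mathrm{Im}\,\mathbb A)$. Impedance function: $V_\Theta(z)=K^*(\mathrm{Re}\,\mathbb A-zI)^{-1}K$, $z\in\rho(\hat A)$. Parameters: for normalized $g_\pm\in\mathrm{Ker}(\dot A^*\mp iI)$, the von Neumann parameter $\kappa$ of $T$ is defined by $g_+-\kappa g_-\in\mathrm{Dom}(T)$, $|\kappa|<1$; $g_\pm$ are chosen (changing the phase of $g_-$) so that $0\le\kappa<1$. The parameter $U$ ($|U|=1$) of $\hat A$ is defined, with respect to the same pair, by $g_++Ug_-\in\mathrm{Dom}(\hat A)$. (The pair used for $\Theta^Q$ may differ by the phase of $g_-$ from the one in the Hypothesis for $\Theta_0$.) *)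

theory Defs
  imports "HOL-Analysis.Analysis"
begin

section \<open>Complex Hilbert spaces\<close>

text \<open>The inner product is linear in the first argument.\<close>

class complex_hilbert = banach +
  fixes scaleC :: "complex \<Rightarrow> 'a \<Rightarrow> 'a" (infixr "*\<^sub>C" 75)
    and cinner :: "'a \<Rightarrow> 'a \<Rightarrow> complex"
  assumes scaleC_add_right: "c *\<^sub>C (x + y) = c *\<^sub>C x + c *\<^sub>C y"
    and scaleC_add_left: "(c + d) *\<^sub>C x = c *\<^sub>C x + d *\<^sub>C x"
    and scaleC_scaleC: "c *\<^sub>C d *\<^sub>C x = (c * d) *\<^sub>C x"
    and scaleR_scaleC: "r *\<^sub>R x = complex_of_real r *\<^sub>C x"
    and cinner_commute: "cinner x y = cnj (cinner y x)"
    and cinner_add_left: "cinner (x + y) z = cinner x z + cinner y z"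
    and cinner_scaleC_left: "cinner (c *\<^sub>C x) y = c * cinner x y"
    and cinner_self: "cinner x x = complex_of_real ((norm x)\<^sup>2)"

lemma vector_space_scaleC:
  "vector_space (scaleC :: complex \<Rightarrow> 'a \<Rightarrow> 'a::complex_hilbert)"
proof
  fix c d :: complex and x y :: 'a
  show "c *\<^sub>C (x + y) = c *\<^sub>C x + c *\<^sub>C y" by (rule scaleC_add_right)
  show "(c + d) *\<^sub>C x = c *\<^sub>C x + d *\<^sub>C x" by (rule scaleC_add_left)
  show "c *\<^sub>C d *\<^sub>C x = (c * d) *\<^sub>C x" by (rule scaleC_scaleC)
  show "1 *\<^sub>C x = x" using scaleR_scaleC[of 1 x] by simp
qed

global_interpretation complex_vector:
  vector_space "scaleC :: complex \<Rightarrow> 'a \<Rightarrow> 'a::complex_hilbert"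
  by (rule vector_space_scaleC)

instantiation complex :: complex_hilbert
begin

definition scaleC_complex :: "complex \<Rightarrow> complex \<Rightarrow> complex"
  where "scaleC_complex c x = c * x"

definition cinner_complex :: "complex \<Rightarrow> complex \<Rightarrow> complex"
  where "cinner_complex x y = x * cnj y"

instance
proof
  fix c d x y z :: complex and r :: real
  show "c *\<^sub>C (x + y) = c *\<^sub>C x + c *\<^sub>C y"
    unfolding scaleC_complex_def by (rule distrib_left)
  show "(c + d) *\<^sub>C x = c *\<^sub>C x + d *\<^sub>C x"
    unfolding scaleC_complex_def by (rule distrib_right)
  show "c *\<^sub>C d *\<^sub>C x = (c * d) *\<^sub>C x"
    unfolding scaleC_complex_def by (rule mult.assoc[symmetric])
  show "r *\<^sub>R x = complex_of_real r *\<^sub>C x"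
    unfolding scaleC_complex_def by (rule scaleR_conv_of_real)
  show "cinner x y = cnj (cinner y x)"
    unfolding cinner_complex_def by (simp only: complex_cnj_mult complex_cnj_cnj mult.commute)
  show "cinner (x + y) z = cinner x z + cinner y z"
    unfolding cinner_complex_def by (rule distrib_right)
  show "cinner (c *\<^sub>C x) y = c * cinner x y"
    unfolding cinner_complex_def scaleC_complex_def by (rule mult.assoc)
  show "cinner x x = complex_of_real ((norm x)\<^sup>2)"
    unfolding cinner_complex_def by (rule complex_norm_square[symmetric])
qed

end

section \<open>Unbounded operators\<close>

text \<open>
  Operators are represented by their graphs, so that the inclusion of operators is
  \<open>\<subseteq>\<close>, the domain is \<^const>\<open>Domain\<close>, and an operator is closed iff its graph is.
\<close>

type_synonym 'a operator = "('a \<times> 'a) set"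

definition linear_operator :: "'a::complex_hilbert operator \<Rightarrow> bool" where
  "linear_operator A \<longleftrightarrow> single_valued A \<and> (0, 0) \<in> A \<and>
     (\<forall>(f, f') \<in> A. \<forall>(g, g') \<in> A. (f + g, f' + g') \<in> A) \<and>
     (\<forall>c. \<forall>(f, f') \<in> A. (c *\<^sub>C f, c *\<^sub>C f') \<in> A)"

definition op_apply :: "'a operator \<Rightarrow> 'a \<Rightarrow> 'a" where
  "op_apply A f = (THE g. (f, g) \<in> A)"

definition densely_defined :: "'a::complex_hilbert operator \<Rightarrow> bool" where
  "densely_defined A \<longleftrightarrow> closure (Domain A) = UNIV"

text \<open>Adjoint of an operator acting in the closed subspace \<open>M\<close>.\<close>

definition adjoint_in :: "'a::complex_hilbert set \<Rightarrow> 'a operator \<Rightarrow> 'a operator" where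
  "adjoint_in M A = {(g, h). g \<in> M \<and> h \<in> M \<and> (\<forall>(f, f') \<in> A. cinner f' g = cinner f h)}"

abbreviation op_adjoint :: "'a::complex_hilbert operator \<Rightarrow> 'a operator" where
  "op_adjoint \<equiv> adjoint_in UNIV"

definition symmetric_operator :: "'a::complex_hilbert operator \<Rightarrow> bool" where
  "symmetric_operator A \<longleftrightarrow> linear_operator A \<and> densely_defined A \<and> A \<subseteq> op_adjoint A"

definition selfadjoint_operator :: "'a::complex_hilbert operator \<Rightarrow> bool" where
  "selfadjoint_operator A \<longleftrightarrow> linear_operator A \<and> densely_defined A \<and> op_adjoint A = A"

definition resolvent_set :: "'a::complex_hilbert operator \<Rightarrow> complex set" where
  "resolvent_set A = {z. (\<forall>h. \<exists>!f. (f, h + z *\<^sub>C f) \<in> A) \<and>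
     (\<exists>C. \<forall>(f, g) \<in> A. norm f \<le> C * norm (g - z *\<^sub>C f))}"

text \<open>The kernel of \<open>A - zI\<close>.\<close>

definition eigenspace :: "'a::complex_hilbert operator \<Rightarrow> complex \<Rightarrow> 'a set" where
  "eigenspace A z = {f. (f, z *\<^sub>C f) \<in> A}"

definition deficiency_indices_1_1 :: "'a::complex_hilbert operator \<Rightarrow> bool" where
  "deficiency_indices_1_1 A \<longleftrightarrow>
     complex_vector.dim (eigenspace (op_adjoint A) \<i>) = 1 \<and>
     complex_vector.dim (eigenspace (op_adjoint A) (- \<i>)) = 1"

text \<open>
  \<open>M\<close> reduces \<open>A\<close> iff the orthogonal projection \<open>P\<close> onto \<open>M\<close> maps \<open>Dom(A)\<close> into itself and
  commutes with \<open>A\<close>; the vectors \<open>f\<^sub>1\<close>, \<open>g\<^sub>1\<close> below are \<open>P f\<close> and \<open>P (A f)\<close>.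
\<close>

definition reduces :: "'a::complex_hilbert set \<Rightarrow> 'a operator \<Rightarrow> bool" where
  "reduces M A \<longleftrightarrow> closed M \<and> complex_vector.subspace M \<and>
     (\<forall>(f, g) \<in> A. \<exists>(f\<^sub>1, g\<^sub>1) \<in> A \<inter> M \<times> M.
        \<forall>h \<in> M. cinner (f - f\<^sub>1) h = 0 \<and> cinner (g - g\<^sub>1) h = 0)"

text \<open>
  Prime: no nonzero reducing subspace on which the operator is self-adjoint. (A part equal
  to its adjoint in \<open>M\<close> is automatically densely defined in \<open>M\<close>, being single-valued.)
\<close>

definition prime_operator :: "'a::complex_hilbert operator \<Rightarrow> bool" where
  "prime_operator A \<longleftrightarrow>
     \<not> (\<exists>M. M \<noteq> {0} \<and> reduces M A \<and> adjoint_in M (A \<inter> M \<times> M) = A \<inter> M \<times> M)"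

section \<open>The rigged Hilbert space generated by a symmetric operator\<close>

definition H_plus :: "'a::complex_hilbert operator \<Rightarrow> 'a set" where
  "H_plus A = Domain (op_adjoint A)"

definition cinner_plus :: "'a::complex_hilbert operator \<Rightarrow> 'a \<Rightarrow> 'a \<Rightarrow> complex" where
  "cinner_plus A f g =
     cinner f g + cinner (op_apply (op_adjoint A) f) (op_apply (op_adjoint A) g)"

definition norm_plus :: "'a::complex_hilbert operator \<Rightarrow> 'a \<Rightarrow> real" where
  "norm_plus A f = sqrt (Re (cinner_plus A f f))"

text \<open>
  \<open>H_minus A\<close> consists of the bounded antilinear functionals on \<open>H_plus A\<close>, the value of
  \<open>\<phi>\<close> at \<open>f\<close> being the pairing \<open>(\<phi>, f)\<close>. Functionals are set to 0 outside \<open>H_plus A\<close>, so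
  that equality of functions is equality in \<open>H_minus A\<close>.
\<close>

definition H_minus :: "'a::complex_hilbert operator \<Rightarrow> ('a \<Rightarrow> complex) set" where
  "H_minus A = {\<phi>.
     (\<forall>f \<in> H_plus A. \<forall>g \<in> H_plus A. \<phi> (f + g) = \<phi> f + \<phi> g) \<and>
     (\<forall>c. \<forall>f \<in> H_plus A. \<phi> (c *\<^sub>C f) = cnj c * \<phi> f) \<and>
     (\<exists>C. \<forall>f \<in> H_plus A. cmod (\<phi> f) \<le> C * norm_plus A f) \<and>
     (\<forall>f. f \<notin> H_plus A \<longrightarrow> \<phi> f = 0)}"

definition norm_minus :: "'a::complex_hilbert operator \<Rightarrow> ('a \<Rightarrow> complex) \<Rightarrow> real" where
  "norm_minus A \<phi> = (SUP f \<in> H_plus A. cmod (\<phi> f) / norm_plus A f)"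

definition embed_minus :: "'a::complex_hilbert operator \<Rightarrow> 'a \<Rightarrow> 'a \<Rightarrow> complex" where
  "embed_minus A h = (\<lambda>f. if f \<in> H_plus A then cinner h f else 0)"

text \<open>The bounded operators from \<open>H_plus A\<close> to \<open>H_minus A\<close>, and from the complex numbers to
  \<open>H_minus A\<close>.\<close>

definition bounded_plus_minus ::
  "'a::complex_hilbert operator \<Rightarrow> ('a \<Rightarrow> 'a \<Rightarrow> complex) \<Rightarrow> bool" where
  "bounded_plus_minus A B \<longleftrightarrow>
     (\<forall>f \<in> H_plus A. B f \<in> H_minus A) \<and>
     (\<forall>f \<in> H_plus A. \<forall>g \<in> H_plus A. B (f + g) = (\<lambda>h. B f h + B g h)) \<and>
     (\<forall>c. \<forall>f \<in> H_plus A. B (c *\<^sub>C f) = (\<lambda>h. c * B f h)) \<and>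
     (\<exists>C. \<forall>f \<in> H_plus A. norm_minus A (B f) \<le> C * norm_plus A f)"

definition bounded_complex_minus ::
  "'a::complex_hilbert operator \<Rightarrow> (complex \<Rightarrow> 'a \<Rightarrow> complex) \<Rightarrow> bool" where
  "bounded_complex_minus A K \<longleftrightarrow>
     (\<forall>c. K c \<in> H_minus A) \<and>
     (\<forall>c d. K (c + d) = (\<lambda>h. K c h + K d h)) \<and>
     (\<forall>a c. K (a * c) = (\<lambda>h. a * K c h)) \<and>
     (\<exists>C. \<forall>c. norm_minus A (K c) \<le> C * cmod c)"

text \<open>The adjoint is given by \<open>(B f, g) = (f, B\<^sup>* g)\<close>, where \<open>(f, \<phi>)\<close> is the complex conjugate
  of \<open>(\<phi>, f)\<close>.\<close>

definition adjoint_plus_minus ::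
  "'a::complex_hilbert operator \<Rightarrow> ('a \<Rightarrow> 'a \<Rightarrow> complex) \<Rightarrow> 'a \<Rightarrow> 'a \<Rightarrow> complex" where
  "adjoint_plus_minus A B g = (\<lambda>f. if f \<in> H_plus A then cnj (B f g) else 0)"

definition Re_plus_minus ::
  "'a::complex_hilbert operator \<Rightarrow> ('a \<Rightarrow> 'a \<Rightarrow> complex) \<Rightarrow> 'a \<Rightarrow> 'a \<Rightarrow> complex" where
  "Re_plus_minus A B f = (\<lambda>g. (B f g + adjoint_plus_minus A B f g) / 2)"

definition Im_plus_minus ::
  "'a::complex_hilbert operator \<Rightarrow> ('a \<Rightarrow> 'a \<Rightarrow> complex) \<Rightarrow> 'a \<Rightarrow> 'a \<Rightarrow> complex" where
  "Im_plus_minus A B f = (\<lambda>g. (B f g - adjoint_plus_minus A B f g) / (2 * \<i>))"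

text \<open>The adjoint \<open>K\<^sup>*\<close>, mapping \<open>H_plus A\<close> to the complex numbers.\<close>

definition adjoint_channel :: "(complex \<Rightarrow> 'a \<Rightarrow> complex) \<Rightarrow> 'a \<Rightarrow> complex" where
  "adjoint_channel K f = cnj (K 1 f)"

lemma adjoint_channel:
  assumes "bounded_complex_minus A K"
  shows "K c f = cinner c (adjoint_channel K f)"
proof -
  have "K (c * 1) = (\<lambda>h. c * K 1 h)"
    using assms unfolding bounded_complex_minus_def by blast
  then have "K c f = c * K 1 f" by (simp only: mult_1_right)
  then show ?thesis
    unfolding adjoint_channel_def cinner_complex_def complex_cnj_cnj .
qed

section \<open>L-systems\<close>

record 'a lsystem =
  symm_op :: "'a operator"
  main_op :: "'a operator"
  state_op :: "'a \<Rightarrow> 'a \<Rightarrow> complex"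
  channel_op :: "complex \<Rightarrow> 'a \<Rightarrow> complex"

text \<open>\<open>extended_by A T B\<close>: the operator \<open>T\<close> in the Hilbert space is a restriction of \<open>B\<close>, which
  maps \<open>H_plus A\<close> to \<open>H_minus A\<close>.\<close>

definition extended_by ::
  "'a::complex_hilbert operator \<Rightarrow> 'a operator \<Rightarrow> ('a \<Rightarrow> 'a \<Rightarrow> complex) \<Rightarrow> bool" where
  "extended_by A T B \<longleftrightarrow> (\<forall>(f, g) \<in> T. f \<in> H_plus A \<and> B f = embed_minus A g)"

definition quasi_kernel_op ::
  "'a::complex_hilbert operator \<Rightarrow> ('a \<Rightarrow> 'a \<Rightarrow> complex) \<Rightarrow> 'a operator" where
  "quasi_kernel_op A B =
     {(f, h). f \<in> H_plus A \<and> Re_plus_minus A B f = embed_minus A h}"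

definition star_extension ::
  "'a::complex_hilbert operator \<Rightarrow> 'a operator \<Rightarrow> ('a \<Rightarrow> 'a \<Rightarrow> complex) \<Rightarrow> bool" where
  "star_extension A T B \<longleftrightarrow>
     bounded_plus_minus A B \<and>
     A \<subseteq> T \<and> extended_by A T B \<and>
     A \<subseteq> op_adjoint T \<and> extended_by A (op_adjoint T) (adjoint_plus_minus A B) \<and>
     selfadjoint_operator (quasi_kernel_op A B)"

definition admissible_main_operator ::
  "'a::complex_hilbert operator \<Rightarrow> 'a operator \<Rightarrow> bool" where
  "admissible_main_operator A T \<longleftrightarrow>
     linear_operator T \<and> \<not> symmetric_operator T \<and>
     A \<subseteq> T \<and> T \<subseteq> op_adjoint A \<and> resolvent_set T \<noteq> {} \<and>
     Domain A = Domain T \<inter> Domain (op_adjoint T)"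

definition L_system :: "'a::complex_hilbert lsystem \<Rightarrow> bool" where
  "L_system \<Theta> \<longleftrightarrow>
     (let A = symm_op \<Theta>; T = main_op \<Theta>; B = state_op \<Theta>; K = channel_op \<Theta> in
        symmetric_operator A \<and> closed A \<and> prime_operator A \<and> deficiency_indices_1_1 A \<and>
        admissible_main_operator A T \<and> star_extension A T B \<and>
        bounded_complex_minus A K \<and>
        (\<forall>f \<in> H_plus A. Im_plus_minus A B f = K (adjoint_channel K f)) \<and>
        range K = Im_plus_minus A B ` H_plus A)"

definition quasi_kernel :: "'a::complex_hilbert lsystem \<Rightarrow> 'a operator" where
  "quasi_kernel \<Theta> = quasi_kernel_op (symm_op \<Theta>) (state_op \<Theta>)"

text \<open>
  \<open>K\<^sup>* (Re B - zI)^-1 K\<close> for \<open>z\<close> in the resolvent set of the quasi-kernel; this operator on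
  the one-dimensional space of complex numbers is identified with its value at 1.
\<close>

definition impedance :: "'a::complex_hilbert lsystem \<Rightarrow> complex \<Rightarrow> complex" where
  "impedance \<Theta> z =
     (let A = symm_op \<Theta>; B = state_op \<Theta>; K = channel_op \<Theta> in
        adjoint_channel K
          (inv_into (H_plus A) (\<lambda>f g. Re_plus_minus A B f g - z * embed_minus A f g) (K 1)))"

section \<open>Von Neumann parameters and the Donoghue class\<close>

definition normalized_deficiency_pair ::
  "'a::complex_hilbert operator \<Rightarrow> 'a \<Rightarrow> 'a \<Rightarrow> bool" where
  "normalized_deficiency_pair A gp gm \<longleftrightarrow>
     gp \<in> eigenspace (op_adjoint A) \<i> \<and> norm gp = 1 \<and>
     gm \<in> eigenspace (op_adjoint A) (- \<i>) \<and> norm gm = 1"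

definition main_parameter ::
  "'a::complex_hilbert lsystem \<Rightarrow> 'a \<Rightarrow> 'a \<Rightarrow> complex \<Rightarrow> bool" where
  "main_parameter \<Theta> gp gm \<kappa> \<longleftrightarrow>
     normalized_deficiency_pair (symm_op \<Theta>) gp gm \<and>
     cmod \<kappa> < 1 \<and> gp - \<kappa> *\<^sub>C gm \<in> Domain (main_op \<Theta>)"

definition quasi_kernel_parameter ::
  "'a::complex_hilbert lsystem \<Rightarrow> 'a \<Rightarrow> 'a \<Rightarrow> complex \<Rightarrow> bool" where
  "quasi_kernel_parameter \<Theta> gp gm U \<longleftrightarrow>
     normalized_deficiency_pair (symm_op \<Theta>) gp gm \<and>
     cmod U = 1 \<and> gp + U *\<^sub>C gm \<in> Domain (quasi_kernel \<Theta>)"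

definition class_M :: "(complex \<Rightarrow> complex) \<Rightarrow> bool" where
  "class_M M \<longleftrightarrow>
     (\<exists>\<mu> :: real measure. sets \<mu> = sets borel \<and> emeasure \<mu> UNIV = \<infinity> \<and>
        (\<integral>t. 1 / (1 + t\<^sup>2) \<partial>\<mu>) = 1 \<and>
        (\<forall>z. Im z \<noteq> 0 \<longrightarrow>
           M z = (\<integral>t. 1 / (complex_of_real t - z) - complex_of_real (t / (1 + t\<^sup>2)) \<partial>\<mu>)))"

end

theory Submission
  imports Defs
begin

text \<open>
  Green's formula and von Neumann's decomposition make the two functionals \<open>u = bp + bm\<close> and
  \<open>n r = r u + \<i> (bp - bm)\<close>, for real \<open>r\<close>, a boundary triplet of the adjoint of the symmetric
  operator: \<open>(A\<^sup>* f, g) - (f, A\<^sup>* g) = n f (u g)\<^sup>* - u f (n g)\<^sup>*\<close>. Every such triplet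
  yields an L-system with state-space operator \<open>(A\<^sup>* f, g) + (u f + \<i> n f) (n g)\<^sup>*\<close>, whose
  impedance function is \<open>n \<phi>\<close> for the solution \<open>\<phi>\<close> of \<open>A\<^sup>* \<phi> = z \<phi>\<close> with \<open>u \<phi> = 1\<close>.
  Conversely, an L-system whose quasi-kernel contains \<open>gp - gm\<close> is of this form for some \<open>r\<close>, up to
  a factor \<open>c\<close> in the channel operator, and then its impedance function is \<open>\<bar>c\<bar>\<^sup>2 n \<phi>\<close>. Functions
  of class \<open>M\<close> take the value \<open>\<i>\<close> at \<open>\<i>\<close>, which forces \<open>r = 0\<close> and \<open>\<bar>c\<bar> = 1\<close>; adding \<open>Q\<close> to the
  impedance function is the same as passing from \<open>r = 0\<close> to \<open>r = Q\<close>, without changing the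
  quasi-kernel as an operator. The parameters are then read off, the phase \<open>\<theta>\<close> being that of
  \<open>\<i> Q / (2 + \<i> Q)\<close>.
\<close>

section \<open>Complex Hilbert spaces\<close>

lemma cinner_add_right: "cinner x (y + z) = cinner x y + cinner x z"
  for x :: "'a::complex_hilbert"
  by (metis cinner_add_left cinner_commute complex_cnj_add)

lemma cinner_scaleC_right: "cinner x (c *\<^sub>C y) = cnj c * cinner x y"
  for x :: "'a::complex_hilbert"
  by (metis cinner_scaleC_left cinner_commute complex_cnj_mult)

lemma cinner_zero_left: "cinner 0 x = 0" for x :: "'a::complex_hilbert"
  using cinner_add_left[of 0 0 x] by simp

lemma cinner_zero_right: "cinner x 0 = 0" for x :: "'a::complex_hilbert"
  using cinner_add_right[of x 0 0] by simp

lemma cinner_diff_left: "cinner (x - y) z = cinner x z - cinner y z"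
  for x :: "'a::complex_hilbert"
  by (metis cinner_add_left add_diff_cancel_right' diff_add_cancel)

lemma cinner_diff_right: "cinner x (y - z) = cinner x y - cinner x z"
  for x :: "'a::complex_hilbert"
  by (metis cinner_add_right add_diff_cancel_right' diff_add_cancel)

lemma cinner_minus_left: "cinner (- x) y = - cinner x y" for x :: "'a::complex_hilbert"
  using cinner_diff_left[of 0 x y] by (simp add: cinner_zero_left)

lemma cinner_minus_right: "cinner x (- y) = - cinner x y" for x :: "'a::complex_hilbert"
  using cinner_diff_right[of x 0 y] by (simp add: cinner_zero_right)

lemmas cinner_simps = cinner_minus_left cinner_minus_right
  cinner_zero_left cinner_zero_right cinner_add_left cinner_add_right
  cinner_diff_left cinner_diff_right cinner_scaleC_left cinner_scaleC_right

lemma norm_scaleC: "norm (c *\<^sub>C x) = cmod c * norm x" for x :: "'a::complex_hilbert"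
proof -
  have "complex_of_real ((norm (c *\<^sub>C x))\<^sup>2) = (c * cnj c) * complex_of_real ((norm x)\<^sup>2)"
    unfolding cinner_self[symmetric] by (simp add: cinner_simps)
  then have "complex_of_real ((norm (c *\<^sub>C x))\<^sup>2) = complex_of_real ((cmod c)\<^sup>2 * (norm x)\<^sup>2)"
    by (simp only: of_real_mult complex_norm_square[symmetric])
  then have "(norm (c *\<^sub>C x))\<^sup>2 = (cmod c * norm x)\<^sup>2"
    unfolding of_real_eq_iff by (simp add: power_mult_distrib)
  then show ?thesis by (simp add: power2_eq_iff_nonneg)
qed

lemma norm_add_square: "(norm (x + y))\<^sup>2 = (norm x)\<^sup>2 + (norm y)\<^sup>2 + 2 * Re (cinner x y)"
  for x :: "'a::complex_hilbert"
proof -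
  have "complex_of_real ((norm (x + y))\<^sup>2)
      = complex_of_real ((norm x)\<^sup>2) + complex_of_real ((norm y)\<^sup>2) + (cinner x y + cinner y x)"
    unfolding cinner_self[symmetric] by (simp add: cinner_simps)
  also have "cinner x y + cinner y x = complex_of_real (2 * Re (cinner x y))"
    using cinner_commute[of y x] by (simp add: complex_eq_iff)
  finally show ?thesis by (metis of_real_add of_real_eq_iff)
qed

lemma norm_diff_square: "(norm (x - y))\<^sup>2 = (norm x)\<^sup>2 + (norm y)\<^sup>2 - 2 * Re (cinner x y)"
  for x :: "'a::complex_hilbert"
  using norm_add_square[of x "- y"] cinner_diff_right[of x 0 y] by (simp add: cinner_zero_right)

text \<open>Cauchy-Schwarz: \<open>s x - c y\<close> with \<open>s = |y|^2\<close> and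
  \<open>c = (x, y)\<close> is \<open>s\<close> times the component of \<open>x\<close> orthogonal
  to \<open>y\<close>, and its squared norm is nonnegative.\<close>

lemma cmod_cinner_le: "cmod (cinner x y) \<le> norm x * norm y" for x :: "'a::complex_hilbert"
proof (cases "y = 0")
  case True
  then show ?thesis by (simp add: cinner_zero_right)
next
  case False
  define c where "c = cinner x y"
  define s where "s = (norm y)\<^sup>2"
  have s: "s > 0" using False by (simp add: s_def)
  have "0 \<le> (norm (complex_of_real s *\<^sub>C x - c *\<^sub>C y))\<^sup>2" by simp
  also have "\<dots> = s\<^sup>2 * (norm x)\<^sup>2 + (cmod c)\<^sup>2 * s - 2 * (s * (cmod c)\<^sup>2)"
    unfolding norm_diff_square
    by (simp add: norm_scaleC power_mult_distrib cinner_simps s_def c_def[symmetric]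
        mult.commute[of "cnj c" c] complex_mult_cnj cmod_power2 algebra_simps
        power2_eq_square[of "Re c"] power2_eq_square[of "Im c"])
  also have "\<dots> = s * (s * (norm x)\<^sup>2 - (cmod c)\<^sup>2)"
    by (simp add: algebra_simps power2_eq_square)
  finally have "(cmod c)\<^sup>2 \<le> s * (norm x)\<^sup>2"
    using s by (simp add: zero_le_mult_iff)
  then have "(cmod c)\<^sup>2 \<le> (norm x * norm y)\<^sup>2"
    by (simp add: s_def power_mult_distrib mult.commute)
  then show ?thesis unfolding c_def by (rule power2_le_imp_le) simp
qed

lemma tendsto_cinner_left:
  fixes y :: "'a::complex_hilbert"
  assumes "(f \<longlongrightarrow> x) F"
  shows "((\<lambda>t. cinner (f t) y) \<longlongrightarrow> cinner x y) F"
proof (rule Lim_null[THEN iffD2], rule Lim_null_comparison)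
  show "\<forall>\<^sub>F t in F. norm (cinner (f t) y - cinner x y) \<le> norm (f t - x) * norm y"
    using cmod_cinner_le by (auto simp flip: cinner_diff_left intro!: always_eventually)
  show "((\<lambda>t. norm (f t - x) * norm y) \<longlongrightarrow> 0) F"
    using tendsto_mult_left_zero[OF tendsto_norm_zero[OF Lim_null[THEN iffD1, OF assms]]] .
qed

text \<open>The difference \<open>x - y\<close> is a limit of vectors of \<open>D\<close>, all of
  them orthogonal to it, so it is orthogonal to itself.\<close>

lemma dense_cinner_eq:
  fixes x y :: "'a::complex_hilbert"
  assumes "closure D = UNIV" and "\<And>g. g \<in> D \<Longrightarrow> cinner x g = cinner y g"
  shows "x = y"
proof -
  obtain d where d: "\<And>n. d n \<in> D" "d \<longlonglongrightarrow> x - y"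
    using assms(1) closure_sequential[of "x - y" D] by auto
  have "(\<lambda>n. cinner (d n) (x - y)) \<longlonglongrightarrow> cinner (x - y) (x - y)"
    by (rule tendsto_cinner_left[OF d(2)])
  moreover have "cinner (d n) (x - y) = 0" for n
    using assms(2)[OF d(1)[of n]] cinner_commute[of "d n" x] cinner_commute[of "d n" y]
    by (simp add: cinner_diff_right)
  ultimately have "cinner (x - y) (x - y) = 0"
    by (simp add: LIMSEQ_const_iff)
  then show ?thesis by (simp add: cinner_self)
qed

text \<open>The classical argument: a minimizing sequence for the distance from \<open>h\<close> to
  \<open>M\<close> is Cauchy, its limit attains the distance, and minimality forces
  orthogonality.\<close>

lemma orthogonal_projection:
  fixes M :: "'a::complex_hilbert set"
  assumes M: "complex_vector.subspace M" "closed M"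
  obtains m where "m \<in> M" "\<And>y. y \<in> M \<Longrightarrow> cinner (h - m) y = 0"
proof -
  have ne: "M \<noteq> {}" using M(1) complex_vector.subspace_0 by blast
  define D where "D = infdist h M"
  have D0: "0 \<le> D" by (simp add: D_def infdist_nonneg)
  have D: "D \<le> norm (h - y)" if "y \<in> M" for y
    using infdist_le[OF that, of h] by (simp add: D_def dist_norm)
  have "\<exists>y\<in>M. norm (h - y) < D + 1 / real (Suc n)" for n
  proof (rule ccontr)
    assume "\<not> ?thesis"
    then have "D + 1 / real (Suc n) \<le> (INF y\<in>M. dist h y)"
      by (intro cINF_greatest ne) (auto simp: dist_norm not_less)
    then show False using ne by (simp add: D_def infdist_notempty)
  qed
  then obtain s where s: "\<And>n. s n \<in> M" "\<And>n. norm (h - s n) < D + 1 / real (Suc n)"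
    by metis
  have lim: "(\<lambda>n. norm (h - s n)) \<longlonglongrightarrow> D"
  proof (rule tendsto_sandwich[where f = "\<lambda>_. D" and h = "\<lambda>n. D + 1 / real (Suc n)"])
    show "(\<lambda>n. D + 1 / real (Suc n)) \<longlonglongrightarrow> D"
      using tendsto_add[OF tendsto_const LIMSEQ_inverse_real_of_nat, of D]
      by (simp add: inverse_eq_divide)
  qed (use s D in \<open>auto intro!: always_eventually less_imp_le\<close>)
  \<comment> \<open>Parallelogram law for \<open>h - s i\<close> and \<open>h - s j\<close>: the
    midpoint of \<open>s i\<close> and \<open>s j\<close> lies in \<open>M\<close>, so half their
    sum has norm at least \<open>D\<close>.\<close>
  have par: "(norm (s i - s j))\<^sup>2 \<le> 2 * ((norm (h - s i))\<^sup>2 - D\<^sup>2) + 2 * ((norm (h - s j))\<^sup>2 - D\<^sup>2)"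
    for i j
  proof -
    have "complex_of_real (1/2) *\<^sub>C (s i + s j) \<in> M"
      using M(1) s(1) complex_vector.subspace_add complex_vector.subspace_scale by blast
    then have "D \<le> norm (h - (1/2) *\<^sub>R (s i + s j))"
      using D by (simp add: scaleR_scaleC)
    also have "h - (1/2) *\<^sub>R (s i + s j) = (1/2) *\<^sub>R ((h - s i) + (h - s j))"
      by (simp add: algebra_simps flip: scaleR_add_left)
    finally have "2 * D \<le> norm ((h - s i) + (h - s j))" by simp
    then have "(2 * D)\<^sup>2 \<le> (norm ((h - s i) + (h - s j)))\<^sup>2"
      using D0 by (intro power_mono) auto
    moreover have "(norm (s i - s j))\<^sup>2 = (norm ((h - s i) - (h - s j)))\<^sup>2"
      by (simp add: norm_minus_commute)
    ultimately show ?thesis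
      unfolding norm_add_square norm_diff_square[of "h - s i" "h - s j"]
      by (simp add: power_mult_distrib)
  qed
  have "Cauchy s"
  proof (rule metric_CauchyI)
    fix e :: real assume e: "e > 0"
    have "(\<lambda>n. (norm (h - s n))\<^sup>2) \<longlonglongrightarrow> D\<^sup>2" by (intro tendsto_intros lim)
    moreover have "D\<^sup>2 < D\<^sup>2 + e\<^sup>2 / 4" using e by simp
    ultimately have "\<forall>\<^sub>F n in sequentially. (norm (h - s n))\<^sup>2 < D\<^sup>2 + e\<^sup>2 / 4"
      by (rule order_tendstoD(2))
    then obtain N where N: "\<And>n. n \<ge> N \<Longrightarrow> (norm (h - s n))\<^sup>2 < D\<^sup>2 + e\<^sup>2 / 4"
      by (auto simp: eventually_sequentially)
    have "dist (s i) (s j) < e" if "i \<ge> N" "j \<ge> N" for i j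
    proof -
      have "(norm (s i - s j))\<^sup>2 < e\<^sup>2" using par[of i j] N[OF that(1)] N[OF that(2)] by argo
      then show ?thesis using e by (simp add: dist_norm power_less_imp_less_base)
    qed
    then show "\<exists>N. \<forall>i\<ge>N. \<forall>j\<ge>N. dist (s i) (s j) < e" by blast
  qed
  then obtain m where m: "s \<longlonglongrightarrow> m" using Cauchy_convergent convergentD by blast
  have mM: "m \<in> M" using closed_sequentially[OF M(2)] s(1) m by blast
  have "(\<lambda>n. norm (h - s n)) \<longlonglongrightarrow> norm (h - m)" by (intro tendsto_intros m)
  then have mD: "norm (h - m) = D" using lim LIMSEQ_unique by blast
  have "cinner (h - m) y = 0" if y: "y \<in> M" for y
  proof (rule ccontr)
    assume nz: "cinner (h - m) y \<noteq> 0"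
    define c where "c = cinner (h - m) y"
    \<comment> \<open>Moving from \<open>m\<close> by \<open>t c y\<close> changes the squared
      distance by \<open>t |c|^2 (t |y|^2 - 2)\<close>, which is negative for small
      \<open>t > 0\<close>. The summand 1 keeps the denominator positive and ensures
      \<open>t |y|^2 < 1\<close>.\<close>
    define t where "t = 1 / ((norm y)\<^sup>2 + 1)"
    have t: "t > 0" by (simp add: t_def add_nonneg_pos)
    have ty: "t * (norm y)\<^sup>2 < 1"
      by (simp add: t_def divide_less_eq add_nonneg_pos)
    have "m + (complex_of_real t * c) *\<^sub>C y \<in> M"
      using M(1) mM y complex_vector.subspace_add complex_vector.subspace_scale by blast
    from D[OF this] have "(norm (h - m))\<^sup>2 \<le> (norm (h - m - (complex_of_real t * c) *\<^sub>C y))\<^sup>2"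
      using D0 mD by (intro power_mono) (auto simp: algebra_simps)
    also have "\<dots> = (norm (h - m))\<^sup>2 + t\<^sup>2 * (cmod c)\<^sup>2 * (norm y)\<^sup>2 - 2 * (t * (cmod c)\<^sup>2)"
      unfolding norm_diff_square[of "h - m"]
      by (simp add: norm_scaleC power_mult_distrib norm_mult cinner_scaleC_right c_def[symmetric]
          cmod_power2) (simp add: algebra_simps power2_eq_square)
    finally have "0 \<le> t * (cmod c)\<^sup>2 * (t * (norm y)\<^sup>2 - 2)"
      by (simp add: algebra_simps power2_eq_square)
    moreover have "t * (cmod c)\<^sup>2 > 0" using t nz by (simp add: c_def)
    ultimately show False using ty by (simp add: zero_le_mult_iff)
  qed
  with mM show thesis using that by blast
qed

text \<open>The component of \<open>h\<close> orthogonal to \<open>M\<close> is a multiple of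
  \<open>g\<close>, hence orthogonal both to \<open>h\<close> and to the projection of
  \<open>h\<close>. It is therefore orthogonal to itself.\<close>

lemma orthogonal_complement_span:
  fixes M :: "'a::complex_hilbert set"
  assumes "complex_vector.subspace M" "closed M"
    and "\<And>x. (\<And>y. y \<in> M \<Longrightarrow> cinner x y = 0) \<Longrightarrow> \<exists>c. x = c *\<^sub>C g" and "cinner h g = 0"
  shows "h \<in> M"
proof -
  obtain m where m: "m \<in> M" "\<And>y. y \<in> M \<Longrightarrow> cinner (h - m) y = 0"
    using orthogonal_projection[OF assms(1,2), of h] by blast
  then obtain c where c: "h - m = c *\<^sub>C g" using assms(3) by blast
  have "cinner (h - m) (h - m) = cnj c * cinner h g - cinner (h - m) m"
    by (metis c cinner_diff_right cinner_scaleC_right cinner_diff_left cinner_commute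
       diff_zero m assms(4))
  then have "h - m = 0" using m assms(4) by (simp add: cinner_self)
  then show ?thesis using m(1) by simp
qed

section \<open>Boundary values of a symmetric operator with deficiency indices (1,1)\<close>

lemma op_adjointD: "(g, h) \<in> op_adjoint A \<Longrightarrow> (f, f') \<in> A \<Longrightarrow> cinner f' g = cinner f h"
  by (auto simp: adjoint_in_def)

lemma op_adjointI:
  "(\<And>f f'. (f, f') \<in> A \<Longrightarrow> cinner f' g = cinner f h) \<Longrightarrow> (g, h) \<in> op_adjoint A"
  by (auto simp: adjoint_in_def)

lemma op_adjoint_antimono: "A \<subseteq> B \<Longrightarrow> op_adjoint B \<subseteq> op_adjoint A"
  by (fastforce simp: adjoint_in_def)

lemma eigenspace_span:
  fixes A :: "'a::complex_hilbert operator"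
  assumes "complex_vector.dim (eigenspace A z) = 1" "complex_vector.subspace (eigenspace A z)"
    and "g \<in> eigenspace A z" "g \<noteq> 0" "f \<in> eigenspace A z"
  shows "\<exists>c. f = c *\<^sub>C g"
proof -
  obtain B where "B \<subseteq> eigenspace A z" and B: "eigenspace A z \<subseteq> complex_vector.span B"
    and "card B = complex_vector.dim (eigenspace A z)"
    using complex_vector.basis_exists by metis
  then obtain v where v: "B = {v}" using assms(1) card_1_singletonE by metis
  obtain k where k: "g = k *\<^sub>C v"
    using B assms(3) unfolding v complex_vector.span_singleton by blast
  obtain l where l: "f = l *\<^sub>C v"
    using B assms(5) unfolding v complex_vector.span_singleton by blast
  have "k \<noteq> 0" using k assms(4) by auto
  then have "f = (l / k) *\<^sub>C g" by (simp add: k l scaleC_scaleC)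
  then show ?thesis ..
qed

locale deficient_operator =
  fixes A :: "'a::complex_hilbert operator" and gp gm :: 'a
  assumes symmetric: "symmetric_operator A" and closed_graph: "closed A"
    and deficiency: "deficiency_indices_1_1 A"
    and pair: "normalized_deficiency_pair A gp gm"
begin

abbreviation "H \<equiv> H_plus A"
abbreviation "S f \<equiv> op_apply (op_adjoint A) f"

lemma dense_domain: "closure (Domain A) = UNIV"
  using symmetric by (simp add: symmetric_operator_def densely_defined_def)

lemma adjoint_unique:
  assumes "(f, g) \<in> op_adjoint A" "(f, h) \<in> op_adjoint A"
  shows "g = h"
proof (rule dense_cinner_eq[OF dense_domain])
  fix k assume "k \<in> Domain A"
  then show "cinner g k = cinner h k"
    using assms op_adjointD cinner_commute by (metis DomainE)
qed

lemma adjoint_iff: "(f, g) \<in> op_adjoint A \<longleftrightarrow> f \<in> H \<and> g = S f"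
proof -
  have "(f, S f) \<in> op_adjoint A" if "f \<in> H"
    using that adjoint_unique unfolding H_plus_def op_apply_def
    by (metis (mono_tags, lifting) DomainE theI')
  then show ?thesis using adjoint_unique by (auto simp: H_plus_def)
qed

lemma adjointI: "f \<in> H \<Longrightarrow> (f, S f) \<in> op_adjoint A"
  by (simp add: adjoint_iff)

lemma graph_iff: "(f, g) \<in> A \<longleftrightarrow> f \<in> Domain A \<and> g = S f"
proof -
  have "A \<subseteq> op_adjoint A" using symmetric by (simp add: symmetric_operator_def)
  then have "g = S f" if "(f, g) \<in> A" for f g using that adjoint_iff by blast
  then show ?thesis by auto
qed

lemma domain_H: "f \<in> Domain A \<Longrightarrow> f \<in> H"
  using symmetric adjoint_iff unfolding symmetric_operator_def by (metis DomainE subsetD)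

lemma adjoint_add: "(f, f') \<in> op_adjoint A \<Longrightarrow> (g, g') \<in> op_adjoint A
    \<Longrightarrow> (f + g, f' + g') \<in> op_adjoint A"
  by (intro op_adjointI) (simp add: cinner_simps op_adjointD[of f f'] op_adjointD[of g g'])

lemma adjoint_scaleC: "(f, f') \<in> op_adjoint A \<Longrightarrow> (c *\<^sub>C f, c *\<^sub>C f') \<in> op_adjoint A"
  by (intro op_adjointI) (simp add: cinner_simps op_adjointD[of f f'])

lemma H_add [simp]: "f \<in> H \<Longrightarrow> g \<in> H \<Longrightarrow> f + g \<in> H"
  and S_add [simp]: "f \<in> H \<Longrightarrow> g \<in> H \<Longrightarrow> S (f + g) = S f + S g"
  using adjoint_add adjoint_iff by metis+

lemma H_scaleC [simp]: "f \<in> H \<Longrightarrow> c *\<^sub>C f \<in> H"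
  and S_scaleC [simp]: "f \<in> H \<Longrightarrow> S (c *\<^sub>C f) = c *\<^sub>C S f"
  using adjoint_scaleC adjoint_iff by metis+

lemma H_0 [simp]: "0 \<in> H" and S_0 [simp]: "S 0 = 0"
proof -
  have "(0, 0) \<in> op_adjoint A" by (simp add: op_adjointI cinner_simps)
  then show "0 \<in> H" "S 0 = 0" by (simp_all add: adjoint_iff)
qed

lemma H_diff [simp]: "f \<in> H \<Longrightarrow> g \<in> H \<Longrightarrow> f - g \<in> H"
  and S_diff [simp]: "f \<in> H \<Longrightarrow> g \<in> H \<Longrightarrow> S (f - g) = S f - S g"
  using H_add[of f "(-1) *\<^sub>C g"] S_add[of f "(-1) *\<^sub>C g"] H_scaleC[of g "-1"] S_scaleC[of g "-1"]
  by auto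

lemma subspace_eigenspace: "complex_vector.subspace (eigenspace (op_adjoint A) z)"
  unfolding complex_vector.subspace_def eigenspace_def
  by (auto simp: adjoint_iff scaleC_add_right scaleC_scaleC mult.commute dest: sym[of "_ *\<^sub>C _"])

lemma gp [simp]: "gp \<in> H" "S gp = \<i> *\<^sub>C gp" "cinner gp gp = 1"
  and gm [simp]: "gm \<in> H" "S gm = (- \<i>) *\<^sub>C gm" "cinner gm gm = 1"
  using pair by (simp_all add: normalized_deficiency_pair_def eigenspace_def adjoint_iff cinner_self)

lemma gp_span: "f \<in> H \<Longrightarrow> S f = \<i> *\<^sub>C f \<Longrightarrow> \<exists>c. f = c *\<^sub>C gp"
  and gm_span: "f \<in> H \<Longrightarrow> S f = (- \<i>) *\<^sub>C f \<Longrightarrow> \<exists>c. f = c *\<^sub>C gm"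
proof -
  have gz: "gp \<noteq> 0" "gm \<noteq> 0" using gp(3) gm(3) cinner_zero_left by (metis zero_neq_one)+
  show "\<exists>c. f = c *\<^sub>C gp" if "f \<in> H" "S f = \<i> *\<^sub>C f"
    by (rule eigenspace_span[where A = "op_adjoint A" and z = \<i>])
      (use deficiency pair that gz subspace_eigenspace in
        \<open>auto simp: deficiency_indices_1_1_def normalized_deficiency_pair_def eigenspace_def adjoint_iff\<close>)
  show "\<exists>c. f = c *\<^sub>C gm" if "f \<in> H" "S f = (- \<i>) *\<^sub>C f"
    by (rule eigenspace_span[where A = "op_adjoint A" and z = "- \<i>"])
      (use deficiency pair that gz subspace_eigenspace[of "- \<i>"] in
        \<open>auto simp: deficiency_indices_1_1_def normalized_deficiency_pair_def eigenspace_def adjoint_iff\<close>)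
qed

text \<open>The coefficients of \<open>f\<close> in von Neumann's decomposition
  \<open>H_plus A = Dom(A) \<oplus> span gp \<oplus> span gm\<close>, in a form that does not presuppose it.\<close>

definition bp :: "'a \<Rightarrow> complex" where "bp f = (cinner (S f) gp + \<i> * cinner f gp) / (2 * \<i>)"
definition bm :: "'a \<Rightarrow> complex" where "bm f = (\<i> * cinner f gm - cinner (S f) gm) / (2 * \<i>)"

lemma bp_simps [simp]:
  "f \<in> H \<Longrightarrow> g \<in> H \<Longrightarrow> bp (f + g) = bp f + bp g"
  "f \<in> H \<Longrightarrow> g \<in> H \<Longrightarrow> bp (f - g) = bp f - bp g"
  "f \<in> H \<Longrightarrow> bp (c *\<^sub>C f) = c * bp f"
  "bp gp = 1" "bp gm = 0" "bp 0 = 0"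
  by (simp_all add: bp_def cinner_simps algebra_simps add_divide_distrib diff_divide_distrib)

lemma bm_simps [simp]:
  "f \<in> H \<Longrightarrow> g \<in> H \<Longrightarrow> bm (f + g) = bm f + bm g"
  "f \<in> H \<Longrightarrow> g \<in> H \<Longrightarrow> bm (f - g) = bm f - bm g"
  "f \<in> H \<Longrightarrow> bm (c *\<^sub>C f) = c * bm f"
  "bm gp = 0" "bm gm = 1" "bm 0 = 0"
  by (simp_all add: bm_def cinner_simps algebra_simps add_divide_distrib diff_divide_distrib)

lemma green_domain:
  assumes "f \<in> Domain A" "g \<in> H"
  shows "cinner (S f) g = cinner f (S g)"
  using op_adjointD[OF adjointI[OF assms(2)], of f "S f"] assms(1) by (simp add: graph_iff)

text \<open>Symmetry moves the operator onto \<open>gp\<close> or \<open>gm\<close>, where it acts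
  as multiplication by \<open>\<i>\<close> or \<open>-\<i>\<close>; the two terms of each
  coefficient then cancel.\<close>

lemma boundary_domain:
  assumes "f \<in> Domain A"
  shows "bp f = 0" "bm f = 0"
  using assms by (simp_all add: bp_def bm_def green_domain cinner_simps)

section \<open>The range of \<open>A + \<i>\<close> and von Neumann's decomposition\<close>

lemma domain_0 [simp]: "0 \<in> Domain A"
  using symmetric unfolding symmetric_operator_def linear_operator_def by blast

lemma domain_add: "f \<in> Domain A \<Longrightarrow> g \<in> Domain A \<Longrightarrow> f + g \<in> Domain A"
  using symmetric unfolding symmetric_operator_def linear_operator_def by fast

lemma domain_scaleC: "f \<in> Domain A \<Longrightarrow> c *\<^sub>C f \<in> Domain A"
  using symmetric unfolding symmetric_operator_def linear_operator_def by fast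

text \<open>The cross term is the imaginary part of \<open>(S f, f)\<close>, which vanishes by
  symmetry. The identity bounds \<open>f\<close> by its image under \<open>A + \<i>\<close>.\<close>

lemma norm_shift_domain:
  assumes "f \<in> Domain A"
  shows "(norm (S f + \<i> *\<^sub>C f))\<^sup>2 = (norm (S f))\<^sup>2 + (norm f)\<^sup>2"
proof -
  have "Im (cinner (S f) f) = 0"
    using green_domain[OF assms domain_H[OF assms]] cinner_commute[of f "S f"]
    by (metis cnj.sel(2) equal_neg_zero)
  then show ?thesis
    unfolding norm_add_square by (simp add: norm_scaleC cinner_simps)
qed

definition shift_range :: "'a set" where "shift_range = (\<lambda>f. S f + \<i> *\<^sub>C f) ` Domain A"

text \<open>Preimages of a convergent sequence are Cauchy by \<open>norm_shift_domain\<close>, and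
  closedness of the graph puts their limit into the domain.\<close>

lemma closed_shift_range: "closed shift_range"
  unfolding closed_sequential_limits
proof (intro allI impI, elim conjE)
  fix x l assume x: "\<forall>n. x n \<in> shift_range" and l: "x \<longlonglongrightarrow> l"
  have "\<exists>f. f \<in> Domain A \<and> x n = S f + \<i> *\<^sub>C f" for n
    using x[rule_format, of n] by (auto simp: shift_range_def)
  then obtain f where f: "\<And>n. f n \<in> Domain A" "\<And>n. x n = S (f n) + \<i> *\<^sub>C f n"
    by metis
  have le: "norm (f m - f n) \<le> norm (x m - x n)" for m n
  proof -
    have d: "f m - f n \<in> Domain A"
      using domain_add[OF f(1) domain_scaleC[OF f(1)], of m "-1" n] by simp
    have "x m - x n = S (f m - f n) + \<i> *\<^sub>C (f m - f n)"
      using f domain_H by (simp add: complex_vector.scale_right_diff_distrib)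
    then have "(norm (f m - f n))\<^sup>2 \<le> (norm (x m - x n))\<^sup>2"
      using norm_shift_domain[OF d] by simp
    then show ?thesis by (rule power2_le_imp_le) simp
  qed
  have "Cauchy x" using l by (simp add: LIMSEQ_imp_Cauchy)
  have "Cauchy f"
  proof (rule CauchyI)
    fix e :: real assume "e > 0"
    then obtain N where "\<forall>m\<ge>N. \<forall>n\<ge>N. norm (x m - x n) < e" using \<open>Cauchy x\<close> CauchyD by blast
    then show "\<exists>N. \<forall>m\<ge>N. \<forall>n\<ge>N. norm (f m - f n) < e" using le by (meson le_less_trans)
  qed
  then obtain k where k: "f \<longlonglongrightarrow> k" using Cauchy_convergent convergentD by blast
  have "(\<lambda>n. \<i> *\<^sub>C f n) \<longlonglongrightarrow> \<i> *\<^sub>C k"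
  proof (rule Lim_null[THEN iffD2])
    have "norm (\<i> *\<^sub>C f n - \<i> *\<^sub>C k) = norm (f n - k)" for n
      by (simp add: norm_scaleC flip: complex_vector.scale_right_diff_distrib)
    moreover have "(\<lambda>n. norm (f n - k)) \<longlonglongrightarrow> 0"
      using tendsto_norm_zero[OF Lim_null[THEN iffD1, OF k]] .
    ultimately show "(\<lambda>n. \<i> *\<^sub>C f n - \<i> *\<^sub>C k) \<longlonglongrightarrow> 0"
      by (simp add: tendsto_norm_zero_cancel)
  qed
  from tendsto_diff[OF l this] have "(\<lambda>n. S (f n)) \<longlonglongrightarrow> l - \<i> *\<^sub>C k" by (simp add: f(2))
  from tendsto_Pair[OF k this] have "(\<lambda>n. (f n, S (f n))) \<longlonglongrightarrow> (k, l - \<i> *\<^sub>C k)" .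
  moreover have "(f n, S (f n)) \<in> A" for n using f by (simp add: graph_iff)
  ultimately have "(k, l - \<i> *\<^sub>C k) \<in> A"
    using closed_sequentially[OF closed_graph, of "\<lambda>n. (f n, S (f n))"] by simp
  note k = this[unfolded graph_iff, THEN conjunct1] this[unfolded graph_iff, THEN conjunct2]
  have "l = S k + \<i> *\<^sub>C k" by (rule k(2)[unfolded diff_eq_eq])
  then show "l \<in> shift_range" unfolding shift_range_def using k(1) by (rule image_eqI)
qed

lemma subspace_shift_range: "complex_vector.subspace shift_range"
  unfolding complex_vector.subspace_def shift_range_def
proof (intro conjI ballI allI)
  show "0 \<in> (\<lambda>f. S f + \<i> *\<^sub>C f) ` Domain A" by (intro image_eqI[of _ _ 0]) auto
next
  fix x y assume "x \<in> (\<lambda>f. S f + \<i> *\<^sub>C f) ` Domain A" "y \<in> (\<lambda>f. S f + \<i> *\<^sub>C f) ` Domain A"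
  then obtain f g where "f \<in> Domain A" "g \<in> Domain A" "x = S f + \<i> *\<^sub>C f" "y = S g + \<i> *\<^sub>C g" by blast
  then show "x + y \<in> (\<lambda>f. S f + \<i> *\<^sub>C f) ` Domain A"
    by (intro image_eqI[of _ _ "f + g"]) (auto simp: domain_H domain_add scaleC_add_right)
next
  fix c x assume "x \<in> (\<lambda>f. S f + \<i> *\<^sub>C f) ` Domain A"
  then obtain f where "f \<in> Domain A" "x = S f + \<i> *\<^sub>C f" by blast
  then show "c *\<^sub>C x \<in> (\<lambda>f. S f + \<i> *\<^sub>C f) ` Domain A"
    by (intro image_eqI[of _ _ "c *\<^sub>C f"])
      (auto simp: domain_H domain_scaleC scaleC_add_right scaleC_scaleC mult.commute)
qed

text \<open>The orthogonal complement of the range of \<open>A + \<i>\<close> lies in the eigenspace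
  of the adjoint at \<open>\<i>\<close>, which is spanned by \<open>gp\<close>; the range itself is
  closed.\<close>

lemma shift_range_orthogonal:
  assumes "cinner h gp = 0"
  obtains f where "f \<in> Domain A" "h = S f + \<i> *\<^sub>C f"
proof -
  have "h \<in> shift_range"
  proof (rule orthogonal_complement_span[OF subspace_shift_range closed_shift_range _ assms])
    fix x assume x: "\<And>y. y \<in> shift_range \<Longrightarrow> cinner x y = 0"
    have "(x, \<i> *\<^sub>C x) \<in> op_adjoint A"
    proof (rule op_adjointI)
      fix f f' assume "(f, f') \<in> A"
      then have "f' + \<i> *\<^sub>C f \<in> shift_range" by (auto simp: shift_range_def graph_iff)
      then have "cinner (f' + \<i> *\<^sub>C f) x = 0" using x cinner_commute by (metis complex_cnj_zero)
      then show "cinner f' x = cinner f (\<i> *\<^sub>C x)" by (simp add: cinner_simps add_eq_0_iff)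
    qed
    then show "\<exists>c. x = c *\<^sub>C gp" using gp_span adjoint_iff by metis
  qed
  then show thesis using that unfolding shift_range_def by blast
qed

text \<open>If \<open>bp f = 0\<close>, then \<open>S f + \<i> f\<close> is orthogonal to
  \<open>gp\<close> and equals \<open>S x + \<i> x\<close> for some \<open>x\<close> in the domain.
  So \<open>f - x\<close> is an eigenvector at \<open>-\<i>\<close> or zero, a multiple of
  \<open>gm\<close> whose coefficient is \<open>bm f = 0\<close>.\<close>

lemma domain_iff: "f \<in> Domain A \<longleftrightarrow> f \<in> H \<and> bp f = 0 \<and> bm f = 0"
proof
  assume "f \<in> Domain A"
  then show "f \<in> H \<and> bp f = 0 \<and> bm f = 0" using domain_H boundary_domain by blast
next
  assume f: "f \<in> H \<and> bp f = 0 \<and> bm f = 0"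
  then have "cinner (S f + \<i> *\<^sub>C f) gp = 0" by (simp add: bp_def cinner_simps)
  then obtain x where x: "x \<in> Domain A" "S f + \<i> *\<^sub>C f = S x + \<i> *\<^sub>C x"
    using shift_range_orthogonal by metis
  note xH = domain_H[OF x(1)]
  have "S f - S x = (- \<i>) *\<^sub>C (f - x)"
  proof -
    have "S f - S x = - (\<i> *\<^sub>C f - \<i> *\<^sub>C x)" using x(2) by (simp add: algebra_simps)
    then show ?thesis by (simp add: complex_vector.scale_right_diff_distrib)
  qed
  then obtain c where c: "f - x = c *\<^sub>C gm" using gm_span[of "f - x"] f xH by auto
  have "c = bm (f - x)" by (simp add: c)
  also have "\<dots> = 0" using f xH boundary_domain[OF x(1)] by simp
  finally show "f \<in> Domain A" using c x(1) by simp
qed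

lemma von_neumann_decomposition:
  assumes "f \<in> H"
  obtains f0 where "f0 \<in> Domain A" "f = f0 + bp f *\<^sub>C gp + bm f *\<^sub>C gm"
proof
  show "f - bp f *\<^sub>C gp - bm f *\<^sub>C gm \<in> Domain A" using assms by (simp add: domain_iff)
qed simp

text \<open>Only \<open>f\<close> is decomposed. Its part in \<open>Dom(A)\<close> cancels by
  symmetry, and what remains of \<open>g\<close> is its pairing with \<open>gp\<close> and
  \<open>gm\<close>, that is, the conjugated formulas for \<open>bp g\<close> and
  \<open>bm g\<close>.\<close>

lemma green:
  assumes f: "f \<in> H" and g: "g \<in> H"
  shows "cinner (S f) g - cinner f (S g) = 2 * \<i> * (bp f * cnj (bp g) - bm f * cnj (bm g))"
proof -
  obtain f0 where f0: "f0 \<in> Domain A" "f = f0 + bp f *\<^sub>C gp + bm f *\<^sub>C gm"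
    using von_neumann_decomposition[OF f] .
  have p: "2 * \<i> * cnj (bp g) = \<i> * cinner gp g - cinner gp (S g)"
    unfolding bp_def using cinner_commute[of gp] by (simp add: field_simps)
  have m: "2 * \<i> * cnj (bm g) = \<i> * cinner gm g + cinner gm (S g)"
    unfolding bm_def using cinner_commute[of gm] by (simp add: field_simps)
  note f0H = domain_H[OF f0(1)]
  have "S f = S f0 + bp f *\<^sub>C \<i> *\<^sub>C gp + bm f *\<^sub>C (- \<i>) *\<^sub>C gm"
    by (subst f0(2)) (simp add: f0H)
  then have "cinner (S f) g
      = cinner f0 (S g) + bp f * (\<i> * cinner gp g) - bm f * (\<i> * cinner gm g)"
    by (simp add: cinner_simps green_domain[OF f0(1) g])
  moreover have "cinner f (S g) = cinner f0 (S g) + bp f * cinner gp (S g) + bm f * cinner gm (S g)"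
    by (subst f0(2)) (simp add: cinner_simps)
  ultimately have "cinner (S f) g - cinner f (S g)
      = bp f * (\<i> * cinner gp g - cinner gp (S g)) - bm f * (\<i> * cinner gm g + cinner gm (S g))"
    by (simp add: algebra_simps)
  then show ?thesis unfolding p[symmetric] m[symmetric] by (simp add: algebra_simps)
qed


section \<open>The boundary triplet\<close>

definition u :: "'a \<Rightarrow> complex" where "u f = bp f + bm f"

definition n :: "real \<Rightarrow> 'a \<Rightarrow> complex"
  where "n r f = complex_of_real r * u f + \<i> * (bp f - bm f)"

lemma u_simps [simp]:
  "f \<in> H \<Longrightarrow> g \<in> H \<Longrightarrow> u (f + g) = u f + u g"
  "f \<in> H \<Longrightarrow> g \<in> H \<Longrightarrow> u (f - g) = u f - u g"
  "f \<in> H \<Longrightarrow> u (c *\<^sub>C f) = c * u f"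
  "u gp = 1" "u gm = 1" "u 0 = 0"
  by (simp_all add: u_def algebra_simps)

lemma n_simps [simp]:
  "f \<in> H \<Longrightarrow> g \<in> H \<Longrightarrow> n r (f + g) = n r f + n r g"
  "f \<in> H \<Longrightarrow> g \<in> H \<Longrightarrow> n r (f - g) = n r f - n r g"
  "f \<in> H \<Longrightarrow> n r (c *\<^sub>C f) = c * n r f"
  "n r gp = complex_of_real r + \<i>" "n r gm = complex_of_real r - \<i>" "n r 0 = 0"
  by (simp_all add: n_def algebra_simps)

lemma domain_iff_un: "f \<in> Domain A \<longleftrightarrow> f \<in> H \<and> u f = 0 \<and> n r f = 0"
proof -
  have "bp f = 0 \<and> bm f = 0" if "u f = 0" "n r f = 0"
  proof -
    have "bp f + bm f = 0" "bp f - bm f = 0" using that by (auto simp: u_def n_def)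
    then show ?thesis by (simp add: algebra_simps)
  qed
  then show ?thesis by (auto simp: domain_iff u_def n_def)
qed

text \<open>For \<open>r = 0\<close> this is \<open>green\<close> in other coordinates. A real
  \<open>r\<close> adds the same term \<open>r u f (u g)^*\<close> to both sides, so every real
  \<open>r\<close> is admissible.\<close>

lemma green_un:
  assumes "f \<in> H" "g \<in> H"
  shows "cinner (S f) g + u f * cnj (n r g) = cinner f (S g) + n r f * cnj (u g)"
  using green[OF assms] by (simp add: n_def u_def algebra_simps)

lemma n_gp_ne_0: "n r gp \<noteq> 0"
  by (simp add: complex_eq_iff)

section \<open>Bounds in the graph norm\<close>

lemma norm_plus_square: "(norm_plus A f)\<^sup>2 = (norm f)\<^sup>2 + (norm (S f))\<^sup>2"
  by (simp add: norm_plus_def cinner_plus_def cinner_self)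

lemma norm_plus_nonneg [simp]: "0 \<le> norm_plus A f"
  unfolding norm_plus_def cinner_plus_def by (simp add: cinner_self)

lemma norm_le_norm_plus: "norm f \<le> norm_plus A f"
  and norm_S_le_norm_plus: "norm (S f) \<le> norm_plus A f"
  by (rule power2_le_imp_le; simp add: norm_plus_square)+

lemma cmod_bp_le: "cmod (bp f) \<le> norm_plus A f"
  and cmod_bm_le: "cmod (bm f) \<le> norm_plus A f"
proof -
  have ng: "norm gp = 1" "norm gm = 1" using pair by (simp_all add: normalized_deficiency_pair_def)
  have b: "cmod (cinner (S f) g) \<le> norm_plus A f" "cmod (cinner f g) \<le> norm_plus A f"
    if "norm g = 1" for g
    using cmod_cinner_le[of "S f" g] cmod_cinner_le[of f g] that
      norm_le_norm_plus[of f] norm_S_le_norm_plus[of f] by simp_all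
  have "cmod (cinner (S f) gp + \<i> * cinner f gp) \<le> 2 * norm_plus A f"
    using norm_triangle_ineq[of "cinner (S f) gp" "\<i> * cinner f gp"] b[OF ng(1)]
    by (simp add: norm_mult)
  then show "cmod (bp f) \<le> norm_plus A f" by (simp add: bp_def norm_divide norm_mult)
  have "cmod (\<i> * cinner f gm - cinner (S f) gm) \<le> 2 * norm_plus A f"
    using norm_triangle_ineq4[of "\<i> * cinner f gm" "cinner (S f) gm"] b[OF ng(2)]
    by (simp add: norm_mult)
  then show "cmod (bm f) \<le> norm_plus A f" by (simp add: bm_def norm_divide norm_mult)
qed

lemma cmod_u_le: "cmod (u f) \<le> 2 * norm_plus A f"
  using norm_triangle_ineq[of "bp f" "bm f"] cmod_bp_le[of f] cmod_bm_le[of f] by (simp add: u_def)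

lemma cmod_n_le: "cmod (n r f) \<le> 2 * (\<bar>r\<bar> + 1) * norm_plus A f"
proof -
  have "cmod (n r f) \<le> \<bar>r\<bar> * cmod (u f) + cmod (bp f - bm f)"
    unfolding n_def using norm_triangle_ineq[of "complex_of_real r * u f" "\<i> * (bp f - bm f)"]
    by (simp add: norm_mult)
  also have "\<dots> \<le> \<bar>r\<bar> * (2 * norm_plus A f) + 2 * norm_plus A f"
    using norm_triangle_ineq4[of "bp f" "bm f"] cmod_bp_le[of f] cmod_bm_le[of f]
    by (intro add_mono mult_left_mono cmod_u_le) auto
  finally show ?thesis by (simp add: algebra_simps)
qed

lemma H_minusI:
  assumes "\<And>f g. f \<in> H \<Longrightarrow> g \<in> H \<Longrightarrow> \<phi> (f + g) = \<phi> f + \<phi> g"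
    and "\<And>c f. f \<in> H \<Longrightarrow> \<phi> (c *\<^sub>C f) = cnj c * \<phi> f"
    and "\<And>f. f \<in> H \<Longrightarrow> cmod (\<phi> f) \<le> C * norm_plus A f"
    and "\<And>f. f \<notin> H \<Longrightarrow> \<phi> f = 0"
  shows "\<phi> \<in> H_minus A"
  using assms unfolding H_minus_def by blast

lemma norm_minus_le:
  assumes "\<And>f. f \<in> H \<Longrightarrow> cmod (\<phi> f) \<le> C * norm_plus A f" "0 \<le> C"
  shows "norm_minus A \<phi> \<le> C"
  unfolding norm_minus_def
proof (rule cSUP_least)
  show "H \<noteq> {}" using H_0 by blast
  show "cmod (\<phi> f) / norm_plus A f \<le> C" if "f \<in> H" for f
  \<comment> \<open>The supremum also runs over the zero vector, where the quotient is 0 by the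
    convention on division; there \<open>0 \<le> C\<close> is needed.\<close>
  proof (cases "norm_plus A f = 0")
    case False
    then have "norm_plus A f > 0" using norm_plus_nonneg[of f] by linarith
    then show ?thesis using assms(1)[OF that] by (simp add: divide_le_eq)
  qed (simp add: assms(2))
qed

section \<open>L-systems of boundary triplets\<close>

text \<open>In the boundary triplet \<open>(u, n r)\<close> the L-system has a main operator with boundary condition
  \<open>u f + \<i> n f = 0\<close>, a quasi-kernel with condition \<open>u f = 0\<close>, and channel \<open>K\<^sup>* f = n f\<close>.\<close>

definition triplet_state :: "real \<Rightarrow> 'a \<Rightarrow> 'a \<Rightarrow> complex" where
  "triplet_state r f g =
     (if g \<in> H then cinner (S f) g + (u f + \<i> * n r f) * cnj (n r g) else 0)"

definition triplet_channel :: "real \<Rightarrow> complex \<Rightarrow> 'a \<Rightarrow> complex" where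
  "triplet_channel r c g = (if g \<in> H then c * cnj (n r g) else 0)"

definition triplet_main :: "real \<Rightarrow> 'a operator" where
  "triplet_main r = {(f, S f) |f. f \<in> H \<and> u f + \<i> * n r f = 0}"

definition triplet_lsystem :: "real \<Rightarrow> 'a lsystem" where
  "triplet_lsystem r = \<lparr>symm_op = A, main_op = triplet_main r,
     state_op = triplet_state r, channel_op = triplet_channel r\<rparr>"

lemma bounded_triplet_state: "bounded_plus_minus A (triplet_state r)"
proof -
  \<comment> \<open>The summand 1 bounds the inner product by Cauchy-Schwarz; the product consists
    of the bounds for \<open>u f + \<i> * n r f\<close> and for \<open>n r g\<close>.\<close>
  define C where "C = 1 + (2 + 2 * (\<bar>r\<bar> + 1)) * (2 * (\<bar>r\<bar> + 1))"
  have C: "0 \<le> C" by (simp add: C_def)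
  have le: "cmod (triplet_state r f g) \<le> (C * norm_plus A f) * norm_plus A g" if "g \<in> H" for f g
  proof -
    have "cmod (u f + \<i> * n r f) \<le> (2 + 2 * (\<bar>r\<bar> + 1)) * norm_plus A f"
      using norm_triangle_ineq[of "u f" "\<i> * n r f"] cmod_u_le[of f] cmod_n_le[of r f]
      by (simp add: norm_mult algebra_simps)
    then have "cmod ((u f + \<i> * n r f) * cnj (n r g))
        \<le> ((2 + 2 * (\<bar>r\<bar> + 1)) * norm_plus A f) * (2 * (\<bar>r\<bar> + 1) * norm_plus A g)"
      unfolding norm_mult complex_mod_cnj by (intro mult_mono cmod_n_le) auto
    moreover have "cmod (cinner (S f) g) \<le> norm_plus A f * norm_plus A g"
      by (rule order_trans[OF cmod_cinner_le])
        (intro mult_mono norm_le_norm_plus norm_S_le_norm_plus, auto)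
    ultimately show ?thesis
      using that norm_triangle_ineq[of "cinner (S f) g" "(u f + \<i> * n r f) * cnj (n r g)"]
      by (simp add: triplet_state_def C_def algebra_simps)
  qed
  show ?thesis
    unfolding bounded_plus_minus_def
  proof (intro conjI ballI allI exI)
    fix f assume f: "f \<in> H"
    show "triplet_state r f \<in> H_minus A"
      by (rule H_minusI[OF _ _ le])
        (auto simp: triplet_state_def cinner_simps algebra_simps)
    show "norm_minus A (triplet_state r f) \<le> C * norm_plus A f"
      by (rule norm_minus_le[OF le]) (auto simp: C)
  next
    fix f g assume "f \<in> H" "g \<in> H"
    then show "triplet_state r (f + g) = (\<lambda>h. triplet_state r f h + triplet_state r g h)"
      by (auto simp: triplet_state_def cinner_simps algebra_simps)
  next
    fix c f assume "f \<in> H"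
    then show "triplet_state r (c *\<^sub>C f) = (\<lambda>h. c * triplet_state r f h)"
      by (auto simp: triplet_state_def cinner_simps algebra_simps)
  qed
qed

lemma bounded_triplet_channel: "bounded_complex_minus A (triplet_channel r)"
proof -
  have le: "cmod (triplet_channel r c g) \<le> (2 * (\<bar>r\<bar> + 1) * cmod c) * norm_plus A g" if "g \<in> H" for c g
    using that mult_left_mono[OF cmod_n_le[of r g], of "cmod c"]
    by (simp add: triplet_channel_def norm_mult algebra_simps)
  show ?thesis
    unfolding bounded_complex_minus_def
  proof (intro conjI allI exI)
    fix c
    show "triplet_channel r c \<in> H_minus A"
      by (rule H_minusI[OF _ _ le]) (auto simp: triplet_channel_def algebra_simps)
    show "norm_minus A (triplet_channel r c) \<le> 2 * (\<bar>r\<bar> + 1) * cmod c"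
      by (rule norm_minus_le[OF le]) auto
  qed (auto simp: triplet_channel_def algebra_simps)
qed

text \<open>Green's identity carries the operator back to \<open>f\<close> and exchanges the terms
  in \<open>u\<close> and \<open>n\<close>, while conjugation reverses the sign of
  \<open>\<i>\<close>. Hence the real part keeps only the \<open>u\<close> term and the imaginary
  part only the rank-one \<open>n\<close> term.\<close>

lemma adjoint_triplet_state:
  assumes "f \<in> H"
  shows "adjoint_plus_minus A (triplet_state r) f
    = (\<lambda>g. if g \<in> H then cinner (S f) g + (u f - \<i> * n r f) * cnj (n r g) else 0)"
proof
  fix g
  show "adjoint_plus_minus A (triplet_state r) f g
      = (if g \<in> H then cinner (S f) g + (u f - \<i> * n r f) * cnj (n r g) else 0)"
    using green_un[OF assms, of g r] assms cinner_commute[of f "S g"]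
    by (auto simp: adjoint_plus_minus_def triplet_state_def algebra_simps)
qed

lemma Re_triplet_state:
  assumes "f \<in> H"
  shows "Re_plus_minus A (triplet_state r) f
    = (\<lambda>g. if g \<in> H then cinner (S f) g + u f * cnj (n r g) else 0)"
  by (rule ext) (simp add: Re_plus_minus_def adjoint_triplet_state[OF assms] triplet_state_def
    add_divide_distrib diff_divide_distrib algebra_simps)

lemma Im_triplet_state:
  assumes "f \<in> H"
  shows "Im_plus_minus A (triplet_state r) f = triplet_channel r (n r f)"
  by (rule ext) (simp add: Im_plus_minus_def adjoint_triplet_state[OF assms] triplet_state_def
    triplet_channel_def add_divide_distrib algebra_simps)

lemma adjoint_triplet_channel: "f \<in> H \<Longrightarrow> adjoint_channel (triplet_channel r) f = n r f"
  by (simp add: adjoint_channel_def triplet_channel_def)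


section \<open>The main operator of a triplet\<close>

lemma triplet_main_iff: "(f, g) \<in> triplet_main r \<longleftrightarrow> f \<in> H \<and> u f + \<i> * n r f = 0 \<and> g = S f"
  by (auto simp: triplet_main_def)

lemma linear_triplet_main: "linear_operator (triplet_main r)"
proof -
  have "u (f + g) + \<i> * n r (f + g) = 0"
    if "f \<in> H" "g \<in> H" "u f + \<i> * n r f = 0" "u g + \<i> * n r g = 0" for f g
  proof -
    have "u (f + g) + \<i> * n r (f + g) = (u f + \<i> * n r f) + (u g + \<i> * n r g)"
      using that(1,2) by (simp add: algebra_simps)
    then show ?thesis using that by simp
  qed
  moreover have "u (c *\<^sub>C f) + \<i> * n r (c *\<^sub>C f) = 0" if "f \<in> H" "u f + \<i> * n r f = 0" for c f
  proof -
    have "u (c *\<^sub>C f) + \<i> * n r (c *\<^sub>C f) = c * (u f + \<i> * n r f)"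
      using that(1) by (simp add: algebra_simps)
    then show ?thesis using that by simp
  qed
  ultimately show ?thesis
    unfolding linear_operator_def
    by (auto simp: triplet_main_iff single_valued_def)
qed

lemma domain_subset_triplet_main: "A \<subseteq> triplet_main r"
  by (auto simp: graph_iff triplet_main_iff domain_iff_un[of _ r])

lemma triplet_main_subset: "triplet_main r \<subseteq> op_adjoint A"
  by (auto simp: triplet_main_iff adjoint_iff)

text \<open>Spans the domain of the main operator modulo \<open>Dom(A)\<close>.\<close>

definition triplet_vector :: "real \<Rightarrow> 'a" where
  "triplet_vector r = gp - (\<i> * complex_of_real r / (2 + \<i> * complex_of_real r)) *\<^sub>C gm"

lemma triplet_den: "2 + \<i> * complex_of_real r \<noteq> 0"
  by (simp add: complex_eq_iff)

text \<open>For \<open>gp - k gm\<close> the boundary condition reads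
  \<open>\<i> r = k (2 + \<i> r)\<close>, whence the coefficient; then \<open>u\<close> takes the
  value \<open>2 / (2 + \<i> r)\<close>.\<close>

lemma triplet_vector:
  "triplet_vector r \<in> H" "u (triplet_vector r) + \<i> * n r (triplet_vector r) = 0"
  "u (triplet_vector r) \<noteq> 0" "n r (triplet_vector r) \<noteq> 0"
proof -
  show "triplet_vector r \<in> H" by (simp add: triplet_vector_def)
  show *: "u (triplet_vector r) + \<i> * n r (triplet_vector r) = 0"
    using triplet_den[of r] by (simp add: triplet_vector_def field_simps)
  show **: "u (triplet_vector r) \<noteq> 0"
    using triplet_den[of r] by (simp add: triplet_vector_def field_simps)
  then show "n r (triplet_vector r) \<noteq> 0" using * by auto
qed

text \<open>The adjoint is a restriction of the adjoint of \<open>A\<close>. Green's identity tested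
  on the single vector \<open>triplet_vector r\<close> yields the conjugate boundary condition, and
  this condition makes the boundary terms cancel for every \<open>f\<close> of the main
  operator.\<close>

lemma adjoint_triplet_main:
  "op_adjoint (triplet_main r) = {(g, S g) |g. g \<in> H \<and> u g - \<i> * n r g = 0}"
proof (intro equalityI subrelI)
  fix g h assume gh: "(g, h) \<in> op_adjoint (triplet_main r)"
  then have "(g, h) \<in> op_adjoint A"
    using op_adjoint_antimono[OF domain_subset_triplet_main] by blast
  then have g: "g \<in> H" "h = S g" by (simp_all add: adjoint_iff)
  let ?f = "triplet_vector r"
  have "cinner (S ?f) g = cinner ?f (S g)"
    using op_adjointD[OF gh] triplet_vector by (simp add: triplet_main_iff g)
  then have "u ?f * cnj (n r g) = n r ?f * cnj (u g)"
    using green_un[OF triplet_vector(1) g(1), of r r] by simp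
  moreover have "u ?f = - \<i> * n r ?f" using triplet_vector(2)[of r] by (simp add: add_eq_0_iff2)
  ultimately have "n r ?f * cnj (u g) = n r ?f * (- \<i> * cnj (n r g))"
    by (simp add: mult.assoc mult.left_commute)
  then have "cnj (u g) = - \<i> * cnj (n r g)"
    by (rule mult_left_cancel[THEN iffD1, OF triplet_vector(4)])
  then have "cnj (cnj (u g)) = cnj (- \<i> * cnj (n r g))" by (rule arg_cong)
  then have "u g = \<i> * n r g" by simp
  then show "(g, h) \<in> {(g, S g) |g. g \<in> H \<and> u g - \<i> * n r g = 0}" using g by simp
next
  fix g h assume "(g, h) \<in> {(g, S g) |g. g \<in> H \<and> u g - \<i> * n r g = 0}"
  then have g: "g \<in> H" "h = S g" "u g = \<i> * n r g" by auto
  show "(g, h) \<in> op_adjoint (triplet_main r)"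
  proof (rule op_adjointI)
    fix f f' assume "(f, f') \<in> triplet_main r"
    then have f: "f \<in> H" "u f = - \<i> * n r f" "f' = S f"
      by (auto simp: triplet_main_iff add_eq_0_iff2)
    show "cinner f' g = cinner f h" using green_un[OF f(1) g(1), of r] f g by simp
  qed
qed

lemma domain_eq_triplet:
  "Domain A = Domain (triplet_main r) \<inter> Domain (op_adjoint (triplet_main r))"
proof -
  have "u f = 0 \<and> n r f = 0" if "u f + \<i> * n r f = 0" "u f = \<i> * n r f" for f
    using that by simp
  moreover have "Domain (triplet_main r) = {f \<in> H. u f + \<i> * n r f = 0}"
    by (auto simp: triplet_main_def)
  moreover have "Domain (op_adjoint (triplet_main r)) = {f \<in> H. u f = \<i> * n r f}"
    by (auto simp: adjoint_triplet_main)
  moreover have "Domain A = {f \<in> H. u f = 0 \<and> n r f = 0}"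
    using domain_iff_un[of _ r] by blast
  ultimately show ?thesis by auto
qed

lemma not_symmetric_triplet_main: "\<not> symmetric_operator (triplet_main r)"
proof
  assume "symmetric_operator (triplet_main r)"
  then have "(triplet_vector r, S (triplet_vector r)) \<in> op_adjoint (triplet_main r)"
    using triplet_vector[of r] unfolding symmetric_operator_def by (auto simp: triplet_main_iff)
  then show False using triplet_vector[of r] by (simp add: adjoint_triplet_main)
qed

text \<open>Under the boundary condition Green's identity gives
  \<open>Im (S f, f) = |n r f|^2\<close>, so the cross term in the square of the right-hand side is
  nonnegative. This yields injectivity and the resolvent bound at \<open>-\<i>\<close>.\<close>

lemma triplet_main_dissipative:
  assumes "(f, g) \<in> triplet_main r"
  shows "norm f \<le> norm (g + \<i> *\<^sub>C f)"
proof -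
  have f: "f \<in> H" "u f = - \<i> * n r f" "g = S f"
    using assms by (auto simp: triplet_main_iff add_eq_0_iff2)
  have "cinner (S f) f - cnj (cinner (S f) f) = 2 * \<i> * (n r f * cnj (n r f))"
    using green_un[OF f(1) f(1), of r] cinner_commute[of f "S f"] f(2) by (simp add: algebra_simps)
  also have "\<dots> = 2 * \<i> * complex_of_real ((cmod (n r f))\<^sup>2)"
    by (simp only: complex_norm_square)
  finally have "Im (cinner (S f) f) = (cmod (n r f))\<^sup>2"
    by (simp add: complex_eq_iff)
  then have "(norm f)\<^sup>2 \<le> (norm (g + \<i> *\<^sub>C f))\<^sup>2"
    unfolding norm_add_square f(3) by (simp add: norm_scaleC cinner_simps)
  then show ?thesis by (rule power2_le_imp_le) simp
qed

lemma triplet_main_surjective: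
  obtains f where "(f, h - \<i> *\<^sub>C f) \<in> triplet_main r"
proof -
  define c where "c = cinner h gp"
  have "cinner (h - c *\<^sub>C gp) gp = 0" by (simp add: c_def cinner_simps)
  then obtain x where x: "x \<in> Domain A" "h - c *\<^sub>C gp = S x + \<i> *\<^sub>C x"
    using shift_range_orthogonal by metis
  have xH: "x \<in> H" "u x = 0" "n r x = 0" using x(1) domain_iff_un[of x r] by auto
  let ?v = "triplet_vector r"
  \<comment> \<open>The range of \<open>A + \<i>\<close> misses only the direction of
    \<open>gp\<close>. The shifted adjoint annihilates \<open>gm\<close> and sends \<open>gp\<close>
    to \<open>2 \<i> gp\<close>, so this multiple of \<open>?v\<close> supplies the missing
    component.\<close>
  let ?d = "c / (2 * \<i>)"
  let ?f = "x + ?d *\<^sub>C ?v"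
  have v: "S ?v + \<i> *\<^sub>C ?v = (2 * \<i>) *\<^sub>C gp"
  proof -
    have "S (gp - k *\<^sub>C gm) + \<i> *\<^sub>C (gp - k *\<^sub>C gm) = \<i> *\<^sub>C gp + \<i> *\<^sub>C gp" for k
      by (simp add: complex_vector.scale_right_diff_distrib scaleC_scaleC mult.commute)
    then show ?thesis unfolding triplet_vector_def by (simp only: flip: scaleC_add_left mult_2)
  qed
  have "S ?f + \<i> *\<^sub>C ?f = (S x + \<i> *\<^sub>C x) + ?d *\<^sub>C (S ?v + \<i> *\<^sub>C ?v)"
    using xH(1) triplet_vector(1) by (simp add: scaleC_add_right scaleC_scaleC mult.commute)
  also have "\<dots> = (h - c *\<^sub>C gp) + (?d * (2 * \<i>)) *\<^sub>C gp"
    unfolding v x(2)[symmetric] scaleC_scaleC ..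
  also have "?d * (2 * \<i>) = c" by (simp add: complex_eq_iff)
  also have "(h - c *\<^sub>C gp) + c *\<^sub>C gp = h" by simp
  finally have "S ?f = h - \<i> *\<^sub>C ?f" by (metis add_diff_cancel_right')
  moreover have "u ?f + \<i> * n r ?f = ?d * (u ?v + \<i> * n r ?v)"
    using xH triplet_vector(1)[of r] by (simp add: algebra_simps)
  ultimately have "(?f, h - \<i> *\<^sub>C ?f) \<in> triplet_main r"
    using xH triplet_vector(1,2)[of r] by (simp add: triplet_main_iff)
  then show thesis by (rule that)
qed

lemma resolvent_triplet_main: "- \<i> \<in> resolvent_set (triplet_main r)"
proof -
  have "\<exists>!f. (f, h + (- \<i>) *\<^sub>C f) \<in> triplet_main r" for h
  proof -
    obtain f where f: "(f, h - \<i> *\<^sub>C f) \<in> triplet_main r" by (rule triplet_main_surjective)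
    moreover have "g = f" if "(g, h - \<i> *\<^sub>C g) \<in> triplet_main r" for g
    proof -
      have "(g + (-1) *\<^sub>C f, (h - \<i> *\<^sub>C g) + (-1) *\<^sub>C (h - \<i> *\<^sub>C f)) \<in> triplet_main r"
        using linear_triplet_main[of r] f that unfolding linear_operator_def by blast
      from triplet_main_dissipative[OF this]
      show ?thesis by (simp add: algebra_simps)
    qed
    ultimately show ?thesis by auto
  qed
  moreover have "\<forall>(f, g) \<in> triplet_main r. norm f \<le> 1 * norm (g - (- \<i>) *\<^sub>C f)"
    using triplet_main_dissipative by auto
  ultimately show ?thesis unfolding resolvent_set_def by blast
qed

section \<open>The quasi-kernel and the L-system of a triplet\<close>

lemma admissible_triplet_main: "admissible_main_operator A (triplet_main r)"
  unfolding admissible_main_operator_def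
  using linear_triplet_main not_symmetric_triplet_main domain_subset_triplet_main
    triplet_main_subset resolvent_triplet_main domain_eq_triplet by blast

text \<open>Vectors of \<open>Dom(A)\<close>, where \<open>n r\<close> vanishes, force
  \<open>h = S f\<close> by density; then \<open>gp\<close>, where \<open>n r\<close> does not
  vanish, forces \<open>u f = 0\<close>. The result is free of \<open>r\<close>, so the given system
  and the constructed one share their quasi-kernel.\<close>

lemma quasi_kernel_of_Re:
  assumes Re: "\<And>f. f \<in> H \<Longrightarrow>
    Re_plus_minus A B f = (\<lambda>g. if g \<in> H then cinner (S f) g + u f * cnj (n r g) else 0)"
  shows "quasi_kernel_op A B = {(f, S f) |f. f \<in> H \<and> u f = 0}"
proof -
  have "u f = 0 \<and> h = S f"
    if f: "f \<in> H" and eq: "Re_plus_minus A B f = embed_minus A h" for f h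
  proof -
    have eq': "cinner (S f) g + u f * cnj (n r g) = cinner h g" if "g \<in> H" for g
      using fun_cong[OF eq, of g] Re[OF f] that by (simp add: embed_minus_def)
    have h: "h = S f"
    proof (rule dense_cinner_eq[OF dense_domain])
      fix g assume "g \<in> Domain A"
      then show "cinner h g = cinner (S f) g" using eq'[of g] domain_iff_un[of g r] by simp
    qed
    then have "u f * cnj (n r gp) = 0" using eq'[OF gp(1)] by (metis add_cancel_right_right)
    then show ?thesis using h n_gp_ne_0[of r] by (simp del: n_simps)
  qed
  moreover have "Re_plus_minus A B f = embed_minus A (S f)" if "f \<in> H" "u f = 0" for f
    using Re that by (auto simp: embed_minus_def)
  ultimately show ?thesis unfolding quasi_kernel_op_def by auto
qed

lemma quasi_kernel_triplet: "quasi_kernel_op A (triplet_state r) = {(f, S f) |f. f \<in> H \<and> u f = 0}"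
  using Re_triplet_state by (rule quasi_kernel_of_Re)

lemma selfadjoint_quasi_kernel: "selfadjoint_operator {(f, S f) |f. f \<in> H \<and> u f = 0}"
  (is "selfadjoint_operator ?R")
proof -
  have AR: "A \<subseteq> ?R" by (auto simp: graph_iff domain_iff_un[of _ 0])
  have "linear_operator ?R"
    unfolding linear_operator_def by (auto simp: single_valued_def)
  moreover have "densely_defined ?R"
    unfolding densely_defined_def using dense_domain closure_mono[OF Domain_mono[OF AR]] by blast
  moreover have "op_adjoint ?R = ?R"
  proof (intro equalityI subrelI)
    fix g h assume gh: "(g, h) \<in> op_adjoint ?R"
    then have "(g, h) \<in> op_adjoint A" using op_adjoint_antimono[OF AR] by blast
    then have g: "g \<in> H" "h = S g" by (simp_all add: adjoint_iff)
    \<comment> \<open>A vector of the extension on which \<open>n\<close> does not vanish; tested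
      against it, Green's identity reduces to \<open>u g = 0\<close>.\<close>
    have f: "gp - gm \<in> H" "u (gp - gm) = 0" "n 0 (gp - gm) = 2 * \<i>" by simp_all
    then have "(gp - gm, S (gp - gm)) \<in> ?R" by blast
    from op_adjointD[OF gh this] have "u g = 0"
      using green_un[OF f(1) g(1), of 0] g(2) f(2,3) by (simp del: S_diff)
    then show "(g, h) \<in> ?R" using g by blast
  next
    fix g h assume "(g, h) \<in> ?R"
    then have g: "g \<in> H" "u g = 0" "h = S g" by auto
    show "(g, h) \<in> op_adjoint ?R"
    proof (rule op_adjointI)
      fix f f' assume "(f, f') \<in> ?R"
      then have "f \<in> H" "u f = 0" "f' = S f" by auto
      then show "cinner f' g = cinner f h" using green_un[of f g 0] g by simp
    qed
  qed
  ultimately show ?thesis unfolding selfadjoint_operator_def by blast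
qed

lemma star_extension_triplet: "star_extension A (triplet_main r) (triplet_state r)"
  unfolding star_extension_def quasi_kernel_triplet
proof (intro conjI bounded_triplet_state domain_subset_triplet_main selfadjoint_quasi_kernel)
  show "extended_by A (triplet_main r) (triplet_state r)"
    by (auto simp: extended_by_def triplet_main_iff triplet_state_def embed_minus_def)
  show "A \<subseteq> op_adjoint (triplet_main r)"
    unfolding adjoint_triplet_main by (auto simp: graph_iff domain_iff_un[of _ r])
  show "extended_by A (op_adjoint (triplet_main r)) (adjoint_plus_minus A (triplet_state r))"
    unfolding adjoint_triplet_main
    by (auto simp: extended_by_def adjoint_triplet_state embed_minus_def)
qed

lemma L_system_triplet:
  assumes "prime_operator A"
  shows "L_system (triplet_lsystem r)"
proof -
  have "range (triplet_channel r) = Im_plus_minus A (triplet_state r) ` H"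
  proof (intro equalityI subsetI)
    fix x assume "x \<in> range (triplet_channel r)"
    then obtain c where x: "x = triplet_channel r c" by blast
    \<comment> \<open>\<open>n r\<close> takes every complex value already on multiples of
      \<open>gp\<close>.\<close>
    have "x = Im_plus_minus A (triplet_state r) ((c / n r gp) *\<^sub>C gp)"
      using n_gp_ne_0[of r] by (simp add: x Im_triplet_state del: n_simps(4))
    then show "x \<in> Im_plus_minus A (triplet_state r) ` H" by simp
  qed (auto simp: Im_triplet_state)
  then show ?thesis
    unfolding L_system_def triplet_lsystem_def Let_def
    using assms symmetric closed_graph deficiency admissible_triplet_main star_extension_triplet
      bounded_triplet_channel by (simp add: Im_triplet_state adjoint_triplet_channel)
qed


section \<open>Impedance functions and the normal form of a given L-system\<close>

lemma impedance_eq: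
  assumes "symm_op \<Theta> = A"
    and Re: "\<And>f. f \<in> H \<Longrightarrow> Re_plus_minus A (state_op \<Theta>) f
      = (\<lambda>g. if g \<in> H then cinner (S f) g + u f * cnj (n r g) else 0)"
    and K: "channel_op \<Theta> 1 = (\<lambda>g. if g \<in> H then cnj c * cnj (n r g) else 0)"
    and \<phi>: "\<phi> \<in> H" "S \<phi> = z *\<^sub>C \<phi>" "u \<phi> = 1"
    and unique: "\<And>f. f \<in> H \<Longrightarrow> S f = z *\<^sub>C f \<Longrightarrow> u f = 0 \<Longrightarrow> f = 0"
  shows "impedance \<Theta> z = complex_of_real ((cmod c)\<^sup>2) * n r \<phi>"
proof -
  let ?F = "\<lambda>f g. Re_plus_minus A (state_op \<Theta>) f g - z * embed_minus A f g"
  \<comment> \<open>The solution of \<open>(Re - z) f = K 1\<close>: vectors of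
    \<open>Dom(A)\<close> force \<open>S f = z f\<close>, then \<open>gp\<close> forces
    \<open>u f = cnj c\<close>. Assuming \<open>unique\<close> instead of a resolvent condition lets
    the lemma be applied directly at \<open>\<i>\<close> with \<open>\<phi> = gp\<close>.\<close>
  let ?f = "cnj c *\<^sub>C \<phi>"
  have F: "?F f = (\<lambda>g. if g \<in> H then cinner (S f - z *\<^sub>C f) g + u f * cnj (n r g) else 0)"
    if "f \<in> H" for f
    using Re[OF that] by (auto simp: embed_minus_def cinner_simps)
  have "?F ?f = channel_op \<Theta> 1"
    unfolding F[OF H_scaleC[OF \<phi>(1)]] K using \<phi>
    by (auto simp: scaleC_scaleC mult.commute cinner_simps)
  moreover have "f = ?f" if f: "f \<in> H" and eq: "?F f = channel_op \<Theta> 1" for f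
  proof -
    have eq': "cinner (S f - z *\<^sub>C f) g + u f * cnj (n r g) = cnj c * cnj (n r g)" if "g \<in> H" for g
      using fun_cong[OF eq[unfolded F[OF f] K], of g] that by simp
    have "S f - z *\<^sub>C f = 0"
    proof (rule dense_cinner_eq[OF dense_domain])
      fix g assume "g \<in> Domain A"
      then show "cinner (S f - z *\<^sub>C f) g = cinner 0 g"
        using eq'[of g] domain_iff_un[of g r] by (simp add: cinner_zero_left)
    qed
    then have "u f * cnj (n r gp) = cnj c * cnj (n r gp)"
      using eq'[OF gp(1)] by (simp only: cinner_zero_left add_0)
    then have uf: "u f = cnj c" using n_gp_ne_0[of r] by (simp del: n_simps)
    have "f - ?f = 0"
      by (rule unique) (use f \<phi> uf \<open>S f - z *\<^sub>C f = 0\<close> in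
        \<open>simp_all add: scaleC_scaleC mult.commute complex_vector.scale_right_diff_distrib\<close>)
    then show ?thesis by simp
  qed
  \<comment> \<open>\<open>inv_into\<close> chooses some preimage, which the uniqueness just shown
    determines.\<close>
  ultimately have "inv_into H ?F (channel_op \<Theta> 1) = ?f"
    unfolding inv_into_def using \<phi>(1) by (intro some_equality) auto
  then have "impedance \<Theta> z = cnj (channel_op \<Theta> 1 ?f)"
    unfolding impedance_def Let_def assms(1) adjoint_channel_def by simp
  also have "\<dots> = (c * cnj c) * n r \<phi>" using \<phi>(1) by (simp add: K)
  finally show ?thesis by (simp only: complex_norm_square)
qed

lemma weyl_solution:
  assumes "z \<in> resolvent_set {(f, S f) |f. f \<in> H \<and> u f = 0}"
  obtains \<phi> where "\<phi> \<in> H" "S \<phi> = z *\<^sub>C \<phi>" "u \<phi> = 1"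
    "\<And>f. f \<in> H \<Longrightarrow> S f = z *\<^sub>C f \<Longrightarrow> u f = 0 \<Longrightarrow> f = 0"
proof -
  have ex1: "\<exists>!f. f \<in> H \<and> u f = 0 \<and> S f = h + z *\<^sub>C f" for h
  proof -
    have "\<exists>!f. (f, h + z *\<^sub>C f) \<in> {(f, S f) |f. f \<in> H \<and> u f = 0}"
      using assms unfolding resolvent_set_def by blast
    moreover have "(f, g) \<in> {(f, S f) |f. f \<in> H \<and> u f = 0} \<longleftrightarrow> f \<in> H \<and> u f = 0 \<and> S f = g"
      for f g by auto
    ultimately show ?thesis by (simp only:)
  qed
  obtain x where x: "x \<in> H" "u x = 0" "S x = gp + z *\<^sub>C x" using ex1 by blast
  \<comment> \<open>\<open>gp\<close> already has \<open>u gp = 1\<close> but eigenvalue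
    \<open>\<i>\<close>; the correction by \<open>x\<close>, which does not change \<open>u\<close>,
    turns the eigenvalue into \<open>z\<close>.\<close>
  let ?\<phi> = "gp + (z - \<i>) *\<^sub>C x"
  show thesis
  proof (rule that[of ?\<phi>])
    show "S ?\<phi> = z *\<^sub>C ?\<phi>"
      using x by (simp add: scaleC_add_right scaleC_scaleC mult.commute
          complex_vector.scale_left_diff_distrib complex_vector.scale_right_diff_distrib)
    show "f = 0" if "f \<in> H" "S f = z *\<^sub>C f" "u f = 0" for f
      using ex1[of 0] that by (metis H_0 S_0 add_0 complex_vector.scale_zero_right u_simps(6))
  qed (use x in auto)
qed

text \<open>By the Green identity, an L-system whose quasi-kernel contains \<open>gp - gm\<close> is given in the
  boundary triplet \<open>(u, n r)\<close>, where \<open>r\<close> is its only free parameter besides the scale of \<open>K\<close>.\<close>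

lemma L_system_normal_form:
  assumes L: "L_system \<Theta>" and A: "symm_op \<Theta> = A"
    and qk: "gp - gm \<in> Domain (quasi_kernel \<Theta>)"
    and \<kappa>: "cmod \<kappa> < 1" "gp - \<kappa> *\<^sub>C gm \<in> Domain (main_op \<Theta>)"
  obtains r c where
    "\<And>f. f \<in> H \<Longrightarrow> Re_plus_minus A (state_op \<Theta>) f
      = (\<lambda>g. if g \<in> H then cinner (S f) g + u f * cnj (n r g) else 0)"
    "channel_op \<Theta> 1 = (\<lambda>g. if g \<in> H then cnj c * cnj (n r g) else 0)"
proof -
  define B where "B = state_op \<Theta>"
  define K where "K = channel_op \<Theta>"
  define T where "T = main_op \<Theta>"
  define R where "R = Re_plus_minus A B"
  have adm: "admissible_main_operator A T" and star: "star_extension A T B"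
    and bK: "bounded_complex_minus A K"
    and Im: "\<And>f. f \<in> H \<Longrightarrow> Im_plus_minus A B f = K (adjoint_channel K f)"
    using L unfolding L_system_def Let_def A B_def K_def T_def by auto
  have bB: "bounded_plus_minus A B" and AT: "A \<subseteq> T" and TB: "extended_by A T B"
    and AT': "A \<subseteq> op_adjoint T" and TB': "extended_by A (op_adjoint T) (adjoint_plus_minus A B)"
    using star unfolding star_extension_def by auto
  have qk': "gp - gm \<in> Domain (quasi_kernel_op A B)"
    using qk by (simp add: quasi_kernel_def A B_def)
  have Badd: "B (f + g) = (\<lambda>h. B f h + B g h)" if "f \<in> H" "g \<in> H" for f g
    using bB that unfolding bounded_plus_minus_def by blast
  have Bsc: "B (c *\<^sub>C f) = (\<lambda>h. c * B f h)" if "f \<in> H" for f c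
    using bB that unfolding bounded_plus_minus_def by blast
  have Bm: "B f \<in> H_minus A" if "f \<in> H" for f
    using bB that unfolding bounded_plus_minus_def by blast
  have Bradd: "B f (g + h) = B f g + B f h" if "f \<in> H" "g \<in> H" "h \<in> H" for f g h
    using Bm[OF that(1)] that(2,3) unfolding H_minus_def by blast
  have Brsc: "B f (c *\<^sub>C g) = cnj c * B f g" if "f \<in> H" "g \<in> H" for f g c
    using Bm[OF that(1)] that(2) unfolding H_minus_def by blast
  have B0: "B f g = 0" if "f \<in> H" "g \<notin> H" for f g
    using Bm[OF that(1)] that(2) unfolding H_minus_def by blast
  have Rdef: "R f g = (B f g + cnj (B g f)) / 2" if "f \<in> H" "g \<in> H" for f g
    using that by (simp add: R_def Re_plus_minus_def adjoint_plus_minus_def)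
  have R0: "R f g = 0" if "f \<in> H" "g \<notin> H" for f g
    using that B0 by (simp add: R_def Re_plus_minus_def adjoint_plus_minus_def)
  have Radd: "R (f + g) h = R f h + R g h" if "f \<in> H" "g \<in> H" "h \<in> H" for f g h
    using that by (simp add: Rdef Badd Bradd add_divide_distrib)
  have Rsc: "R (c *\<^sub>C f) g = c * R f g" if "f \<in> H" "g \<in> H" for f g c
    using that by (simp add: Rdef Bsc Brsc algebra_simps)
  have Rcnj: "R g f = cnj (R f g)" if "f \<in> H" "g \<in> H" for f g
    using that by (simp add: Rdef add.commute)
  have RA: "R f g = cinner (S f) g" if f: "f \<in> Domain A" and g: "g \<in> H" for f g
  proof -
    have "(f, S f) \<in> A" using f by (simp add: graph_iff)
    then have "B f = embed_minus A (S f)" "adjoint_plus_minus A B f = embed_minus A (S f)"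
      using AT AT' TB TB' unfolding extended_by_def by blast+
    then show ?thesis using g by (simp add: R_def Re_plus_minus_def embed_minus_def)
  qed
  \<comment> \<open>The quasi-kernel supplies only some vector \<open>h\<close>; Hermitian symmetry
    of \<open>R\<close> and testing on \<open>Dom(A)\<close> identify it.\<close>
  have Rq: "R (gp - gm) g = cinner (S (gp - gm)) g" if g: "g \<in> H" for g
  proof -
    obtain h where h: "R (gp - gm) = embed_minus A h"
      using qk' unfolding quasi_kernel_op_def R_def by blast
    have qH: "gp - gm \<in> H" by simp
    have "h = S (gp - gm)"
    proof (rule dense_cinner_eq[OF dense_domain])
      fix x assume x: "x \<in> Domain A"
      note xH = domain_H[OF x]
      have "cinner h x = cnj (R x (gp - gm))"
        using Rcnj[OF xH qH] h xH by (simp add: embed_minus_def)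
      also have "\<dots> = cnj (cinner x (S (gp - gm)))"
        unfolding RA[OF x qH] green_domain[OF x qH] ..
      finally show "cinner h x = cinner (S (gp - gm)) x" by (metis cinner_commute)
    qed
    then show ?thesis using h g by (simp add: embed_minus_def)
  qed
  \<comment> \<open>The kernel of \<open>u\<close> is \<open>Dom(A)\<close> plus the span of
    \<open>gp - gm\<close>, and \<open>R\<close> is known on both.\<close>
  have Rker: "R f g = cinner (S f) g" if f: "f \<in> H" "u f = 0" and g: "g \<in> H" for f g
  proof -
    obtain f0 where f0: "f0 \<in> Domain A" "f = f0 + bp f *\<^sub>C gp + bm f *\<^sub>C gm"
      using von_neumann_decomposition[OF f(1)] .
    have "bm f = - bp f" using f(2) by (simp add: u_def add_eq_0_iff)
    then have f': "f = f0 + bp f *\<^sub>C (gp - gm)"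
      using f0(2) by (metis add.assoc complex_vector.scale_minus_left 
          complex_vector.scale_right_diff_distrib diff_conv_add_uminus)
    note f0H = domain_H[OF f0(1)]
    have q: "gp - gm \<in> H" by simp
    have "R f g = R f0 g + bp f * R (gp - gm) g"
      by (subst f') (simp only: Radd Rsc f0H q g H_scaleC)
    also have "\<dots> = cinner (S f0 + bp f *\<^sub>C S (gp - gm)) g"
      unfolding RA[OF f0(1) g] Rq[OF g] by (simp only: cinner_simps)
    also have "S f0 + bp f *\<^sub>C S (gp - gm) = S (f0 + bp f *\<^sub>C (gp - gm))"
      by (simp only: S_add S_scaleC f0H q H_scaleC)
    finally show ?thesis unfolding f'[symmetric] .
  qed
  \<comment> \<open>Modulo the kernel of \<open>u\<close> only the direction of \<open>gp\<close> is
    left, so this value, real by Hermitian symmetry, is all that \<open>R\<close> still leaves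
    open.\<close>
  define r where "r = Re (R gp gp)"
  have rr: "R gp gp = complex_of_real r"
    using Rcnj[OF gp(1) gp(1)] by (simp add: r_def complex_eq_iff)
  have Rgp: "R gp g = cinner (S gp) g + cnj (n r g)" if g: "g \<in> H" for g
  proof -
    let ?g = "g - u g *\<^sub>C gp"
    have g': "?g \<in> H" "u ?g = 0" "bp ?g = - bm g" using g by (simp_all add: u_def)
    have "R gp ?g = cinner gp (S ?g)"
      using Rcnj[OF g'(1) gp(1)] Rker[OF g'(1,2) gp(1)] by (metis cinner_commute)
    then have 1: "R gp ?g = cinner (S gp) ?g + 2 * \<i> * cnj (bm g)"
      using green[OF gp(1) g'(1)] g'(3) by (simp add: algebra_simps)
    have "R gp g = R gp ?g + cnj (u g) * R gp gp"
      using Radd[OF g'(1) H_scaleC[OF gp(1)] gp(1), of "u g"] Rsc[OF gp(1) gp(1), of "u g"]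
        Rcnj[OF g gp(1)] Rcnj[OF g'(1) gp(1)] Rcnj[OF gp(1) gp(1)] by simp
    also have "\<dots> = cinner (S gp) g + cnj (n r g)"
      unfolding 1 rr by (simp add: cinner_simps n_def u_def algebra_simps)
    finally show ?thesis .
  qed
  have Rall: "R f g = cinner (S f) g + u f * cnj (n r g)" if f: "f \<in> H" and g: "g \<in> H" for f g
  proof -
    let ?f = "f - u f *\<^sub>C gp"
    have f': "?f \<in> H" "u ?f = 0" using f by simp_all
    have "R f g = R ?f g + u f * R gp g"
      using Radd[OF f'(1) H_scaleC[OF gp(1)] g, of "u f"] Rsc[OF gp(1) g, of "u f"] by simp
    also have "\<dots> = cinner (S f) g + u f * cnj (n r g)"
      unfolding Rker[OF f' g] Rgp[OF g] using f by (simp add: cinner_simps algebra_simps)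
    finally show ?thesis .
  qed
  define l where "l = adjoint_channel K"
  have Kl: "K a g = a * cnj (l g)" for a g
    using adjoint_channel[OF bK, of a g] by (simp add: l_def cinner_complex_def)
  let ?v = "gp - \<kappa> *\<^sub>C gm"
  have vH: "?v \<in> H" by simp
  have uv: "u ?v \<noteq> 0" using \<kappa>(1) by auto
  \<comment> \<open>On the domain of the main operator \<open>B\<close> acts as \<open>S\<close>, so
    the boundary term of \<open>R\<close> and \<open>\<i>\<close> times the imaginary part cancel.
    As \<open>u ?v = 1 - \<kappa>\<close> is nonzero, the channel functional \<open>l\<close> is a
    multiple of \<open>n r\<close>.\<close>
  have key: "u ?v * cnj (n r g) = - \<i> * l ?v * cnj (l g)" if g: "g \<in> H" for g
  proof -
    obtain h where h: "(?v, h) \<in> T" using \<kappa>(2) by (auto simp: T_def)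
    then have "h = S ?v" using adm unfolding admissible_main_operator_def
      using adjoint_iff by blast
    then have "B ?v g = cinner (S ?v) g"
      using h TB g unfolding extended_by_def by (auto simp: embed_minus_def)
    moreover have "B ?v g = R ?v g + \<i> * Im_plus_minus A B ?v g"
      by (simp add: R_def Re_plus_minus_def Im_plus_minus_def add_divide_distrib diff_divide_distrib)
    moreover have "Im_plus_minus A B ?v g = l ?v * cnj (l g)"
      using Im[OF vH] Kl by (simp add: l_def)
    ultimately show ?thesis unfolding Rall[OF vH g] by (simp add: algebra_simps)
  qed
  have lv: "l ?v \<noteq> 0" using key[OF gp(1)] uv n_gp_ne_0[of r] by (metis complex_cnj_zero_iff mult_eq_0_iff)
  \<comment> \<open>The factor of proportionality, \<open>l = c n r\<close> on \<open>H\<close>; the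
    conjugation appears because \<open>key\<close> involves \<open>cnj (l g)\<close>.\<close>
  define c where "c = cnj (u ?v / (- \<i> * l ?v))"
  have K1: "K 1 g = cnj c * cnj (n r g)" if g: "g \<in> H" for g
  proof -
    have "cnj (l g) = u ?v * cnj (n r g) / (- \<i> * l ?v)"
      unfolding key[OF g] using lv by (simp del: n_simps u_simps)
    then show ?thesis by (simp add: Kl c_def del: n_simps u_simps)
  qed
  have "K 1 \<in> H_minus A" using bK unfolding bounded_complex_minus_def by blast
  then have "K 1 = (\<lambda>g. if g \<in> H then cnj c * cnj (n r g) else 0)"
    using K1 unfolding H_minus_def by auto
  moreover have "R f = (\<lambda>g. if g \<in> H then cinner (S f) g + u f * cnj (n r g) else 0)" if "f \<in> H" for f
    using Rall R0 that by auto
  ultimately show thesis using that unfolding R_def B_def K_def by blast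
qed

end

text \<open>At \<open>z = \<i>\<close> the integrand equals \<open>\<i> / (1 + t^2)\<close>, so the
  normalization of the measure gives the value.\<close>

lemma class_M_at_i:
  assumes "class_M M"
  shows "M \<i> = \<i>"
proof -
  obtain \<mu> :: "real measure" where \<mu>: "(\<integral>t. 1 / (1 + t\<^sup>2) \<partial>\<mu>) = 1"
    and M: "\<forall>z. Im z \<noteq> 0 \<longrightarrow>
      M z = (\<integral>t. 1 / (complex_of_real t - z) - complex_of_real (t / (1 + t\<^sup>2)) \<partial>\<mu>)"
    using assms unfolding class_M_def by blast
  have Mi: "M \<i> = (\<integral>t. 1 / (complex_of_real t - \<i>) - complex_of_real (t / (1 + t\<^sup>2)) \<partial>\<mu>)"
    by (rule M[rule_format]) simp
  have "1 / (complex_of_real t - \<i>) - complex_of_real (t / (1 + t\<^sup>2))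
      = \<i> * complex_of_real (1 / (1 + t\<^sup>2))" for t
  proof -
    have "1 + t\<^sup>2 \<noteq> 0" by (metis add_nonneg_pos less_irrefl zero_le_power2 zero_less_one add.commute)
    then have ne: "1 + (complex_of_real t)\<^sup>2 \<noteq> 0"
      by (metis of_real_1 of_real_add of_real_eq_0_iff of_real_power)
    have "complex_of_real t - \<i> \<noteq> 0" by (simp add: complex_eq_iff)
    then have "1 / (complex_of_real t - \<i>) = (complex_of_real t + \<i>) / (1 + (complex_of_real t)\<^sup>2)"
      using ne by (simp add: frac_eq_eq algebra_simps power2_eq_square)
    then show ?thesis by (simp add: add_divide_distrib)
  qed
  then show ?thesis using \<mu> by (simp add: Mi del: of_real_divide of_real_add of_real_power)
qed

section \<open>Shifting the impedance function by a real constant\<close>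

theorem theorem35:
  fixes \<Theta>\<^sub>0 :: "'a::complex_hilbert lsystem"
    and gp gm :: 'a and \<kappa>\<^sub>0 :: complex and Q :: real
  assumes "L_system \<Theta>\<^sub>0"
    and "normalized_deficiency_pair (symm_op \<Theta>\<^sub>0) gp gm"
    and "gp - gm \<in> Domain (quasi_kernel \<Theta>\<^sub>0)"
    and "cmod \<kappa>\<^sub>0 < 1" and "gp - \<kappa>\<^sub>0 *\<^sub>C gm \<in> Domain (main_op \<Theta>\<^sub>0)"
    and "class_M (impedance \<Theta>\<^sub>0)"
    and "Q \<noteq> 0"
  shows "\<exists>\<Theta>\<^sub>Q :: 'a lsystem. L_system \<Theta>\<^sub>Q \<and> symm_op \<Theta>\<^sub>Q = symm_op \<Theta>\<^sub>0 \<and>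
    (\<forall>z \<in> resolvent_set (quasi_kernel \<Theta>\<^sub>0) \<inter> resolvent_set (quasi_kernel \<Theta>\<^sub>Q).
       impedance \<Theta>\<^sub>Q z = complex_of_real Q + impedance \<Theta>\<^sub>0 z) \<and>
    (\<exists>\<theta>. cmod \<theta> = 1 \<and>
       main_parameter \<Theta>\<^sub>Q gp (\<theta> *\<^sub>C gm) (complex_of_real (\<bar>Q\<bar> / sqrt (Q\<^sup>2 + 4))) \<and>
       quasi_kernel_parameter \<Theta>\<^sub>Q gp (\<theta> *\<^sub>C gm)
         (complex_of_real (Q / \<bar>Q\<bar>) *
           ((- complex_of_real Q + 2 * \<i>) / complex_of_real (sqrt (Q\<^sup>2 + 4)))))"
proof -
  define A where "A = symm_op \<Theta>\<^sub>0"
  have sysA: "symmetric_operator A" "closed A" "prime_operator A" "deficiency_indices_1_1 A"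
    using assms(1) unfolding L_system_def Let_def A_def by blast+
  interpret deficient_operator A gp gm
    using sysA assms(2) by unfold_locales (simp_all add: A_def)
  obtain r c where Re0: "\<And>f. f \<in> H \<Longrightarrow> Re_plus_minus A (state_op \<Theta>\<^sub>0) f
      = (\<lambda>g. if g \<in> H then cinner (S f) g + u f * cnj (n r g) else 0)"
    and K0: "channel_op \<Theta>\<^sub>0 1 = (\<lambda>g. if g \<in> H then cnj c * cnj (n r g) else 0)"
    by (rule L_system_normal_form[OF assms(1) A_def[symmetric] assms(3,4,5)]) (rule that)
  note V0 = impedance_eq[OF A_def[symmetric] Re0 K0]
  \<comment> \<open>At \<open>z = \<i>\<close> the solution with \<open>u \<phi> = 1\<close> is
    \<open>gp\<close> itself, and \<open>n r gp = r + \<i>\<close>. Comparing with the value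
    \<open>\<i>\<close> of class \<open>M\<close> fixes \<open>\<bar>c\<bar> = 1\<close> by
    imaginary parts, then \<open>r = 0\<close>.\<close>
  have "impedance \<Theta>\<^sub>0 \<i> = complex_of_real ((cmod c)\<^sup>2) * n r gp"
  proof (rule V0)
    show "f = 0" if f: "f \<in> H" "S f = \<i> *\<^sub>C f" "u f = 0" for f
      using gp_span[OF f(1,2)] f(3) by auto
  qed simp_all
  then have eq: "complex_of_real ((cmod c)\<^sup>2) * (complex_of_real r + \<i>) = \<i>"
    using class_M_at_i[OF assms(6)] by simp
  then have c: "(cmod c)\<^sup>2 = 1" by (auto simp: complex_eq_iff)
  have r: "r = 0" using eq unfolding c by simp
  define \<Theta> where "\<Theta> = triplet_lsystem Q"
  have A\<Theta>: "symm_op \<Theta> = A" by (simp add: \<Theta>_def triplet_lsystem_def)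
  have qk0: "quasi_kernel \<Theta>\<^sub>0 = {(f, S f) |f. f \<in> H \<and> u f = 0}"
    unfolding quasi_kernel_def A_def[symmetric] by (rule quasi_kernel_of_Re[OF Re0])
  have qkQ: "quasi_kernel \<Theta> = {(f, S f) |f. f \<in> H \<and> u f = 0}"
    unfolding quasi_kernel_def A\<Theta> by (simp add: \<Theta>_def triplet_lsystem_def quasi_kernel_triplet)
  \<comment> \<open>Both systems have the same quasi-kernel, so one solution \<open>\<phi>\<close>
    serves for both, and \<open>n Q \<phi> = Q + n 0 \<phi>\<close> because
    \<open>u \<phi> = 1\<close>.\<close>
  have "impedance \<Theta> z = complex_of_real Q + impedance \<Theta>\<^sub>0 z"
    if z: "z \<in> resolvent_set (quasi_kernel \<Theta>\<^sub>0)" for z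
  proof -
    obtain \<phi> where \<phi>: "\<phi> \<in> H" "S \<phi> = z *\<^sub>C \<phi>" "u \<phi> = 1"
      "\<And>f. f \<in> H \<Longrightarrow> S f = z *\<^sub>C f \<Longrightarrow> u f = 0 \<Longrightarrow> f = 0"
      using weyl_solution z unfolding qk0 by blast
    have "impedance \<Theta> z = complex_of_real ((cmod 1)\<^sup>2) * n Q \<phi>"
      by (rule impedance_eq[OF A\<Theta> _ _ \<phi>])
        (auto simp: \<Theta>_def triplet_lsystem_def Re_triplet_state triplet_channel_def)
    moreover have "impedance \<Theta>\<^sub>0 z = complex_of_real ((cmod c)\<^sup>2) * n r \<phi>"
      by (rule V0[OF _ \<phi>])
    ultimately show ?thesis using \<phi>(3) c r by (simp add: n_def)
  qed
  \<comment> \<open>The coefficient of \<open>gm\<close> in \<open>triplet_vector Q\<close> divided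
    by its modulus; absorbing this phase into \<open>gm\<close> makes the von Neumann parameter
    nonnegative.\<close>
  moreover define \<theta> where
    "\<theta> = complex_of_real (sqrt (Q\<^sup>2 + 4) / \<bar>Q\<bar>) * (\<i> * complex_of_real Q / (2 + \<i> * complex_of_real Q))"
  have s: "sqrt (Q\<^sup>2 + 4) > 0" by (simp add: add_nonneg_pos)
  have cm: "cmod (2 + \<i> * complex_of_real Q) = sqrt (Q\<^sup>2 + 4)"
    "cmod (- complex_of_real Q + 2 * \<i>) = sqrt (Q\<^sup>2 + 4)"
    by (simp_all add: cmod_def add.commute)
  have \<theta>: "cmod \<theta> = 1" using s assms(7) cm by (simp add: \<theta>_def norm_mult norm_divide)
  have pair': "normalized_deficiency_pair A gp (\<theta> *\<^sub>C gm)"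
    using pair \<theta> by (auto simp: normalized_deficiency_pair_def eigenspace_def adjoint_iff
        norm_scaleC scaleC_scaleC mult.commute)
  let ?\<kappa> = "complex_of_real (\<bar>Q\<bar> / sqrt (Q\<^sup>2 + 4))"
  let ?U = "complex_of_real (Q / \<bar>Q\<bar>)
    * ((- complex_of_real Q + 2 * \<i>) / complex_of_real (sqrt (Q\<^sup>2 + 4)))"
  have "main_parameter \<Theta> gp (\<theta> *\<^sub>C gm) ?\<kappa>"
    unfolding main_parameter_def A\<Theta>
  proof (intro conjI pair')
    have "\<bar>Q\<bar> < sqrt (Q\<^sup>2 + 4)" by (rule real_less_rsqrt) simp
    then show "cmod ?\<kappa> < 1" using s by (simp add: norm_divide)
    have "?\<kappa> * \<theta> = \<i> * complex_of_real Q / (2 + \<i> * complex_of_real Q)"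
      using s assms(7) by (simp add: \<theta>_def)
    then have "gp - ?\<kappa> *\<^sub>C \<theta> *\<^sub>C gm = triplet_vector Q"
      by (simp only: triplet_vector_def scaleC_scaleC)
    then show "gp - ?\<kappa> *\<^sub>C \<theta> *\<^sub>C gm \<in> Domain (main_op \<Theta>)"
      using triplet_vector[of Q] by (auto simp: \<Theta>_def triplet_lsystem_def triplet_main_def)
  qed
  moreover have "quasi_kernel_parameter \<Theta> gp (\<theta> *\<^sub>C gm) ?U"
    unfolding quasi_kernel_parameter_def A\<Theta> qkQ
  proof (intro conjI pair')
    show "cmod ?U = 1" using s assms(7) cm by (simp add: norm_mult norm_divide)
    have cancel: "w * (x / v) * (v / q * (\<i> * y / d)) = (w * (y / q)) * ((x * \<i>) / d)"
      if "v \<noteq> 0" for v w x y q d :: complex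
      using that by simp
    \<comment> \<open>The goal is \<open>?U * \<theta> = -1\<close>, so that the vector in question
      is \<open>gp - gm\<close>, on which \<open>u\<close> vanishes. The square roots cancel, and
      the remaining factor \<open>\<i>\<close> turns \<open>-Q + 2 \<i>\<close> into minus the
      denominator.\<close>
    have "?U * \<theta> = (complex_of_real (Q / \<bar>Q\<bar>) * (complex_of_real Q / complex_of_real \<bar>Q\<bar>))
        * (((- complex_of_real Q + 2 * \<i>) * \<i>) / (2 + \<i> * complex_of_real Q))"
      unfolding \<theta>_def of_real_divide[of "sqrt (Q\<^sup>2 + 4)"] by (rule cancel) (use s in simp)
    also have "(- complex_of_real Q + 2 * \<i>) * \<i> = - (2 + \<i> * complex_of_real Q)"
      by (simp add: algebra_simps)
    also have "complex_of_real (Q / \<bar>Q\<bar>) * (complex_of_real Q / complex_of_real \<bar>Q\<bar>) = 1"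
      using assms(7) by (simp add: abs_if)
    finally have "?U * \<theta> = -1" using triplet_den[of Q] by (simp add: divide_eq_minus_1_iff)
    then show "gp + ?U *\<^sub>C \<theta> *\<^sub>C gm \<in> Domain {(f, S f) |f. f \<in> H \<and> u f = 0}"
      unfolding scaleC_scaleC by auto
  qed
  ultimately show ?thesis
    using L_system_triplet[OF sysA(3), of Q] \<theta> A\<Theta> unfolding A_def \<Theta>_def by blast
qed

end
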